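(* Let $m$ be a nonnegative integer, let $s_0, s_1, \dots, s_m \in \mathbb{C}$ be distinct complex numbers, and let $f(s, z_0, z_1, \dots, z_m)$ be a polynomial in $z_0, \dots, z_m$ whose coefficients are meromorphic functions $\phi(s)$ on $\mathbb{C}$, each with Nevanlinna characteristic satisfying $T(r,\phi) = o(r)$ as $r \to \infty$. If $$f\bigl(s, \zeta(s+s_0), \zeta(s+s_1), \dots, \zeta(s+s_m)\bigr) = 0$$ holds for all $s \in \mathbb{C}$, where $\zeta$ is the Riemann zeta function, then $f$ is identically zero.
   Context: $\zeta$ denotes the Riemann zeta function, regarded as a meromorphic function on $\mathbb{C}$. The equation is understood as an identity between meromorphic functions of $s$ on $\mathbb{C}$; "$f$ is identically zero" means that $f$ is the zero polynomial in $z_0,\dots,z_m$, i.e. every coefficient is the identically zero function. For a meromorphic function $\phi$ on $\mathbb{C}$, the Nevanlinna characteristic is $T(r,\phi) = N(r,\phi) + m(r,\phi)$, where $$N(r,\phi) = \int_0^r \frac{n(t,\phi) - n(0,\phi)}{t}\,dt + n(0,\phi)\log r,$$ $n(r,\phi)$ is the number of poles of $\phi$, counted with multiplicity, in the disc $\{z : |z| \le r\}$, and $$m(r,\phi) = \frac{1}{2\pi}\int_0^{2\pi} \log^+ |\phi(re^{i\theta})|\, d\theta, \qquad \log^+ x = \max\{0, \log x\}.$$ *)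

theory Defs
  imports
    "HOL-Complex_Analysis.Complex_Analysis"
    "HOL-Library.Landau_Symbols"
    "HOL-Library.Function_Algebras"
    "HOL-Library.Poly_Mapping"
begin

text \<open>Keep the binder of \<^const>\<open>suminf\<close> and \<^const>\<open>prodinf\<close> unambiguous.\<close>

no_syntax
  "_Sum_any" :: "pttrn \<Rightarrow> 'a \<Rightarrow> 'a::comm_monoid_add"  (\<open>(\<open>indent=2 notation=\<open>binder \<Sum>\<close>\<close>\<Sum>_. _)\<close> [0, 10] 10)
  "_Prod_any" :: "pttrn \<Rightarrow> 'a \<Rightarrow> 'a::comm_monoid_mult"  (\<open>(\<open>indent=2 notation=\<open>binder \<Prod>\<close>\<close>\<Prod>_. _)\<close> [0, 10] 10)

lemma holomorphic_on_suminf: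
  fixes f :: "nat \<Rightarrow> complex \<Rightarrow> complex"
  assumes S: "open S" and hol: "\<And>n. f n holomorphic_on S"
    and bd: "\<And>x. x \<in> S \<Longrightarrow> \<exists>d>0. cball x d \<subseteq> S \<and>
           (\<exists>M. summable M \<and> (\<forall>n. \<forall>y\<in>cball x d. norm (f n y) \<le> M n))"
  shows "(\<lambda>x. \<Sum>n. f n x) holomorphic_on S" and "\<And>x. x \<in> S \<Longrightarrow> summable (\<lambda>n. f n x)"
proof -
  show "(\<lambda>x. \<Sum>n. f n x) holomorphic_on S"
  proof (rule holomorphic_uniform_sequence[OF S, where f = "\<lambda>n x. \<Sum>k<n. f k x"])
    show "(\<lambda>x. \<Sum>k<n. f k x) holomorphic_on S" for n
      by (intro holomorphic_intros hol)
  next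
    fix x assume "x \<in> S"
    from bd[OF this] obtain d M where "d > 0" "cball x d \<subseteq> S" "summable M"
      "\<forall>n. \<forall>y\<in>cball x d. norm (f n y) \<le> M n" by blast
    moreover from this have "uniform_limit (cball x d) (\<lambda>n x. \<Sum>k<n. f k x) (\<lambda>x. \<Sum>n. f n x) sequentially"
      by (intro Weierstrass_m_test[of "cball x d" f M]) simp_all
    ultimately show "\<exists>d>0. cball x d \<subseteq> S \<and>
        uniform_limit (cball x d) (\<lambda>n x. \<Sum>k<n. f k x) (\<lambda>x. \<Sum>n. f n x) sequentially"
      by blast
  qed
next
  fix x assume "x \<in> S"
  from bd[OF this] obtain d M where "d > 0" "summable M"
      "\<forall>n. \<forall>y\<in>cball x d. norm (f n y) \<le> M n" by blast
  then have "norm (f n x) \<le> M n" for n by simp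
  with \<open>summable M\<close> show "summable (\<lambda>n. f n x)"
    by (intro summable_comparison_test'[of M 0 "\<lambda>n. f n x"]) simp_all
qed

lemma norm_powr_bound_summable:
  assumes "a < (-1::real)"
  shows "summable (\<lambda>n. real (Suc n) powr a)"
  using assms summable_Suc_iff[of "\<lambda>n. real n powr a"] summable_real_powr_iff by blast

lemma dirichlet_series:
  shows "(\<lambda>s. \<Sum>n. 1 / of_nat (Suc n) powr s) holomorphic_on {s. Re s > 1}"
    and "\<And>s. Re s > 1 \<Longrightarrow> summable (\<lambda>n. 1 / of_nat (Suc n) powr (s::complex))"
proof -
  have op: "open {s::complex. Re s > 1}" by (simp add: open_halfspace_Re_gt)
  have hol: "(\<lambda>s. 1 / of_nat (Suc n) powr s) holomorphic_on {s. Re s > 1}" for n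
    by (intro holomorphic_intros) auto
  have bd: "\<exists>d>0. cball x d \<subseteq> {s. Re s > 1} \<and>
           (\<exists>M. summable M \<and> (\<forall>n. \<forall>y\<in>cball x d. norm (1 / of_nat (Suc n) powr y) \<le> M n))"
    if "x \<in> {s. Re s > 1}" for x :: complex
  proof -
    define d where "d = (Re x - 1) / 2"
    have d: "d > 0" using that by (simp add: d_def)
    have re: "Re y \<ge> 1 + d" if "y \<in> cball x d" for y
    proof -
      have "Re x - Re y \<le> d"
        using that complex_Re_le_cmod[of "x - y"] by (simp add: dist_norm)
      then show ?thesis by (simp add: d_def field_simps)
    qed
    have "norm (1 / of_nat (Suc n) powr y) \<le> real (Suc n) powr (- 1 - d)" if "y \<in> cball x d" for y n
    proof -
      have "norm (1 / of_nat (Suc n) powr y) = real (Suc n) powr (- Re y)"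
        using norm_powr_real_powr[of "of_nat (Suc n)" y]
        by (simp add: norm_divide powr_minus_divide del: of_nat_Suc)
      also have "\<dots> \<le> real (Suc n) powr (- 1 - d)"
        using re[OF that] by (intro powr_mono) auto
      finally show ?thesis .
    qed
    moreover have "cball x d \<subseteq> {s. Re s > 1}" using re d by force
    moreover have "summable (\<lambda>n. real (Suc n) powr (-1 - d))" using d by (intro norm_powr_bound_summable) auto
    ultimately show ?thesis using d
      by (intro exI[of _ d] conjI exI[of _ "\<lambda>n. real (Suc n) powr (-1 - d)"]) blast+
  qed
  show "(\<lambda>s. \<Sum>n. 1 / of_nat (Suc n) powr s) holomorphic_on {s. Re s > 1}"
    by (rule holomorphic_on_suminf(1)[OF op hol bd])
  show "\<And>s. Re s > 1 \<Longrightarrow> summable (\<lambda>n. 1 / of_nat (Suc n) powr (s::complex))"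
    using holomorphic_on_suminf(2)[OF op hol bd] by simp
qed

definition zeta_series :: "complex \<Rightarrow> complex" where
  "zeta_series s = (\<Sum>n. 1 / of_nat (Suc n) powr s)"

lemma zeta_series_holomorphic: "zeta_series holomorphic_on {s. Re s > 1}"
  unfolding zeta_series_def by (rule dirichlet_series(1))

lemma zeta_series_sums: "Re s > 1 \<Longrightarrow> (\<lambda>n. 1 / of_nat (Suc n) powr s) sums zeta_series s"
  unfolding zeta_series_def by (intro summable_sums dirichlet_series(2))

text \<open>
  The Dirichlet series is continued by expanding \<open>(n + 1) powr (1 - s)\<close> around \<open>n\<close> to order
  \<open>M\<close> and summing over \<open>n\<close>: the left-hand side telescopes, the Taylor terms become values of the
  series at \<open>s, s + 1, \<dots>\<close>, and the sum of the remainders converges in a larger half-plane.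
\<close>

definition tcoeff :: "nat \<Rightarrow> complex \<Rightarrow> complex" where
  "tcoeff k s = (\<Prod>j<k. 1 - s - of_nat j) / fact k"

lemma tcoeff_holomorphic: "tcoeff k holomorphic_on S"
  unfolding tcoeff_def by (intro holomorphic_intros) simp_all

definition trem :: "nat \<Rightarrow> nat \<Rightarrow> complex \<Rightarrow> complex" where
  "trem M n s = of_nat (Suc (Suc n)) powr (1 - s)
      - (\<Sum>k\<le>M. tcoeff k s * of_nat (Suc n) powr (1 - s - of_nat k))"

lemma trem_bound:
  assumes "Re s + real M \<ge> 0"
  shows "norm (trem M n s) \<le> norm (\<Prod>j<Suc M. 1 - s - of_nat j) * real (Suc n) powr (- Re s - real M)"
proof -
  let ?S = "closed_segment (of_nat (Suc n)) (of_nat (Suc (Suc n))) :: complex set"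
  define f where "f = (\<lambda>i x. (\<Prod>j<i. 1 - s - of_nat j) * x powr (1 - s - of_nat i))"
  have S: "\<exists>u. x = of_real u \<and> u \<ge> real (Suc n)" if x: "x \<in> ?S" for x
  proof -
    obtain v where "0 \<le> v" "v \<le> 1" "x = (1 - v) *\<^sub>R of_nat (Suc n) + v *\<^sub>R of_nat (Suc (Suc n))"
      using x by (auto simp: in_segment)
    then show ?thesis
      by (intro exI[of _ "real (Suc n) + v"]) (auto simp: complex_eq_iff algebra_simps)
  qed
  have B: "cmod (f (Suc M) x) \<le> norm (\<Prod>j<Suc M. 1 - s - of_nat j) * real (Suc n) powr (- Re s - real M)"
    if "x \<in> ?S" for x
  proof -
    obtain u where u: "x = of_real u" "u \<ge> real (Suc n)" using S \<open>x \<in> ?S\<close> by blast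
    have "norm (x powr (1 - s - of_nat (Suc M))) = u powr (- Re s - real M)"
      using norm_powr_real_powr[of x "1 - s - of_nat (Suc M)"] u by simp
    also have "\<dots> \<le> real (Suc n) powr (- Re s - real M)"
      using u assms by (intro powr_mono2') auto
    finally show ?thesis unfolding f_def norm_mult
      by (intro mult_left_mono) auto
  qed
  have D: "(f i has_field_derivative f (Suc i) x) (at x within ?S)" if "x \<in> ?S" for i x
  proof -
    obtain u where u: "x = of_real u" "u \<ge> real (Suc n)" using S \<open>x \<in> ?S\<close> by blast
    then have nz: "x \<notin> \<real>\<^sub>\<le>\<^sub>0" by auto
    have "((\<lambda>x. x powr (1 - s - of_nat i)) has_field_derivative
        (1 - s - of_nat i) * x powr (1 - s - of_nat i - 1)) (at x)"
      using nz by (rule has_field_derivative_powr)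
    from DERIV_cmult[OF this, of "\<Prod>j<i. 1 - s - of_nat j"]
    have "(f i has_field_derivative f (Suc i) x) (at x)"
      by (simp add: f_def mult.assoc diff_diff_eq add.commute)
    then show ?thesis by (rule has_field_derivative_at_within)
  qed
  have "cmod (f 0 (of_nat (Suc (Suc n))) - (\<Sum>i\<le>M. f i (of_nat (Suc n)) *
      (of_nat (Suc (Suc n)) - of_nat (Suc n)) ^ i / fact i)) \<le>
     (norm (\<Prod>j<Suc M. 1 - s - of_nat j) * real (Suc n) powr (- Re s - real M)) *
      cmod (of_nat (Suc (Suc n)) - of_nat (Suc n)) ^ Suc M / fact M"
    by (rule complex_Taylor[OF convex_closed_segment D B ends_in_segment])
  also have "\<dots> \<le> (norm (\<Prod>j<Suc M. 1 - s - of_nat j) * real (Suc n) powr (- Re s - real M))"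
  proof -
    have "B * x ^ Suc M / fact M \<le> B" if "B \<ge> 0" "x = 1" for B x :: real
      using that mult_left_mono[OF fact_ge_1, of B M] by (simp add: divide_le_eq)
    then show ?thesis by simp
  qed
  also have "f 0 (of_nat (Suc (Suc n))) - (\<Sum>i\<le>M. f i (of_nat (Suc n)) *
      (of_nat (Suc (Suc n)) - of_nat (Suc n)) ^ i / fact i) = trem M n s"
    by (simp add: f_def trem_def tcoeff_def)
  finally show ?thesis .
qed

lemma trem_holomorphic:
  shows "(\<lambda>s. \<Sum>n. trem (N + 2) n s) holomorphic_on {s. Re s > - real N}"
    and "\<And>s. Re s > - real N \<Longrightarrow> summable (\<lambda>n. trem (N + 2) n s)"
proof -
  let ?S = "{s. Re s > - real N}"
  have op: "open ?S" by (simp add: open_halfspace_Re_gt)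
  have hol: "trem (N + 2) n holomorphic_on ?S" for n
    unfolding trem_def
    by (intro holomorphic_intros tcoeff_holomorphic) (simp_all del: of_nat_Suc)
  have bd: "\<exists>d>0. cball x d \<subseteq> ?S \<and>
           (\<exists>M. summable M \<and> (\<forall>n. \<forall>y\<in>cball x d. norm (trem (N + 2) n y) \<le> M n))"
    if "x \<in> ?S" for x
  proof -
    define d where "d = (Re x + real N) / 2"
    have d: "d > 0" using that by (simp add: d_def)
    have re: "Re y \<ge> d - real N" if "y \<in> cball x d" for y
    proof -
      have "Re x - Re y \<le> d"
        using that complex_Re_le_cmod[of "x - y"] by (simp add: dist_norm)
      then show ?thesis by (simp add: d_def field_simps)
    qed
    define P where "P = (\<lambda>s::complex. \<Prod>j<Suc (N + 2). 1 - s - of_nat j)"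
    have "compact (P ` cball x d)"
      unfolding P_def by (intro compact_continuous_image continuous_intros compact_cball)
    then have "bounded (P ` cball x d)" by (rule compact_imp_bounded)
    then obtain C where C: "\<forall>y\<in>cball x d. norm (P y) \<le> C"
      unfolding bounded_iff by blast
    have "norm (trem (N + 2) n y) \<le> C * real (Suc n) powr (-2)" if "y \<in> cball x d" for y n
    proof -
      have "norm (trem (N + 2) n y) \<le> norm (P y) * real (Suc n) powr (- Re y - real (N + 2))"
        unfolding P_def using re[OF that] d by (intro trem_bound) simp_all
      also have "\<dots> \<le> C * real (Suc n) powr (-2)"
      proof (rule mult_mono)
        show "norm (P y) \<le> C" using C that by blast
        then show "0 \<le> C" using norm_ge_zero order_trans by blast
        show "real (Suc n) powr (- Re y - real (N + 2)) \<le> real (Suc n) powr (-2)"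
          using re[OF that] d by (intro powr_mono) simp_all
      qed simp
      finally show ?thesis .
    qed
    moreover have "cball x d \<subseteq> ?S" using re d by force
    moreover have "summable (\<lambda>n. C * real (Suc n) powr (-2))"
      by (intro summable_mult norm_powr_bound_summable) auto
    ultimately show ?thesis using d
      by (intro exI[of _ d] conjI exI[of _ "\<lambda>n. C * real (Suc n) powr (-2)"]) blast+
  qed
  show "(\<lambda>s. \<Sum>n. trem (N + 2) n s) holomorphic_on ?S"
    by (rule holomorphic_on_suminf(1)[OF op hol bd])
  show "\<And>s. Re s > - real N \<Longrightarrow> summable (\<lambda>n. trem (N + 2) n s)"
    using holomorphic_on_suminf(2)[OF op hol bd] by simp
qed

lemma zeta_series_recurrence:
  assumes s: "Re s > 1"
  shows "(s - 1) * zeta_series s = 1 + (\<Sum>n. trem (N + 2) n s) + (\<Sum>k=2..N+2. tcoeff k s * zeta_series (s + of_nat k - 1))"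
proof -
  have summ: "(\<lambda>n. trem (N + 2) n s) sums (\<Sum>n. trem (N + 2) n s)"
    using s by (intro summable_sums trem_holomorphic(2)) auto
  have "(\<lambda>n. of_nat (Suc n) powr (1 - s)) \<longlonglongrightarrow> 0"
  proof (rule tendsto_norm_zero_cancel)
    have "(\<lambda>n. real (Suc n) powr (1 - Re s)) \<longlonglongrightarrow> 0"
      using s by (intro LIMSEQ_Suc tendsto_neg_powr filterlim_real_sequentially) auto
    also have "(\<lambda>n. real (Suc n) powr (1 - Re s)) = (\<lambda>n. norm (of_nat (Suc n) powr (1 - s)))"
    proof
      fix n show "real (Suc n) powr (1 - Re s) = norm (of_nat (Suc n) powr (1 - s))"
        using norm_powr_real_powr[of "of_nat (Suc n)" "1 - s"] by (simp del: of_nat_Suc)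
    qed
    finally show "(\<lambda>n. norm (of_nat (Suc n) powr (1 - s))) \<longlonglongrightarrow> 0" .
  qed
  from telescope_sums[OF this]
  have tel: "(\<lambda>n. of_nat (Suc (Suc n)) powr (1 - s) - of_nat (Suc n) powr (1 - s)) sums (-1)"
    by simp
  have "(\<lambda>n. \<Sum>k=1..N+2. tcoeff k s * (1 / of_nat (Suc n) powr (s + of_nat k - 1)))
      sums (\<Sum>k=1..N+2. tcoeff k s * zeta_series (s + of_nat k - 1))"
    using s by (intro sums_sum sums_mult zeta_series_sums) auto
  from sums_diff[OF tel this]
  have "(\<lambda>n. trem (N + 2) n s) sums (- 1 - (\<Sum>k=1..N+2. tcoeff k s * zeta_series (s + of_nat k - 1)))"
  proof (rule sums_cong[THEN iffD1, rotated])
    fix n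
    have pw: "1 / of_nat (Suc n) powr (s + of_nat k - 1) = of_nat (Suc n) powr (1 - s - of_nat k)" for k
      using powr_minus[of "of_nat (Suc n)" "s + of_nat k - 1"]
      by (simp add: divide_inverse algebra_simps del: of_nat_Suc)
    have "{..N+2} = insert 0 {1..N+2}" by auto
    then show "of_nat (Suc (Suc n)) powr (1 - s) - of_nat (Suc n) powr (1 - s) -
       (\<Sum>k=1..N+2. tcoeff k s * (1 / of_nat (Suc n) powr (s + of_nat k - 1))) = trem (N + 2) n s"
      unfolding trem_def pw by (simp add: tcoeff_def del: of_nat_Suc sum.atLeast1_atMost_eq sum.cl_ivl_Suc prod.lessThan_Suc)
  qed
  with summ have "(\<Sum>n. trem (N + 2) n s) = - 1 - (\<Sum>k=1..N+2. tcoeff k s * zeta_series (s + of_nat k - 1))"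
    by (rule sums_unique2)
  also have "(\<Sum>k=1..N+2. tcoeff k s * zeta_series (s + of_nat k - 1)) =
      tcoeff 1 s * zeta_series s + (\<Sum>k=2..N+2. tcoeff k s * zeta_series (s + of_nat k - 1))"
  proof -
    have "{1..N+2} = insert 1 {2..N+2}" by auto
    then show ?thesis by (simp del: sum.cl_ivl_Suc)
  qed
  also have "tcoeff 1 s = 1 - s" by (simp add: tcoeff_def)
  finally have "(\<Sum>n. trem (N + 2) n s) =
      - 1 - ((1 - s) * zeta_series s + (\<Sum>k=2..N+2. tcoeff k s * zeta_series (s + of_nat k - 1)))" .
  then show ?thesis by (simp add: left_diff_distrib)
qed

lemma tcoeff_step:
  assumes "k \<ge> 2"
  shows "tcoeff k s * Z = - (tcoeff (k - 1) s / of_nat k) * ((s + of_nat k - 1 - 1) * Z)"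
proof -
  obtain j where j: "k = Suc j" using assms(1) by (cases k) auto
  define p where "p = (\<Prod>i<j. 1 - s - of_nat i)"
  have "tcoeff k s = p * (1 - s - of_nat j) / (of_nat k * fact j)"
    unfolding tcoeff_def p_def j prod.lessThan_Suc fact_Suc by (rule refl)
  moreover have "tcoeff (k - 1) s = p / fact j" by (simp add: j tcoeff_def p_def)
  moreover have "s + of_nat k - 1 - 1 = - (1 - s - of_nat j)" by (simp add: j)
  ultimately show ?thesis by (simp only: times_divide_eq_left times_divide_eq_right divide_divide_eq_left
      mult_minus_right mult_minus_left minus_minus minus_divide_left mult_ac)
qed

lemma continuation_halfplane:
  "\<exists>h. h holomorphic_on {s. Re s > 1 - real N} \<and> (\<forall>s. Re s > 1 \<longrightarrow> h s = (s - 1) * zeta_series s)"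
proof (induction N)
  case 0
  show ?case
    by (rule exI[of _ "\<lambda>s. (s - 1) * zeta_series s"]) (auto intro!: holomorphic_intros zeta_series_holomorphic)
next
  case (Suc N)
  then obtain h where h: "h holomorphic_on {s. Re s > 1 - real N}"
    "\<And>s. Re s > 1 \<Longrightarrow> h s = (s - 1) * zeta_series s" by blast
  let ?S = "{s. Re s > - real N}"
  define g where "g = (\<lambda>s. 1 + (\<Sum>n. trem (N + 2) n s) +
     (\<Sum>k=2..N+2. - (tcoeff (k - 1) s / of_nat k) * h (s + of_nat k - 1)))"
  have hs: "(\<lambda>s. h (s + of_nat k - 1)) holomorphic_on ?S" if "k \<in> {2..N+2}" for k
  proof -
    have "h \<circ> (\<lambda>s. s + of_nat k - 1) holomorphic_on ?S"
      by (rule holomorphic_on_compose_gen[OF _ h(1)]) (use that in \<open>auto intro!: holomorphic_intros\<close>)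
    then show ?thesis by (simp add: o_def)
  qed
  have "(\<lambda>s. - (tcoeff (k - 1) s / of_nat k) * h (s + of_nat k - 1)) holomorphic_on ?S"
    if "k \<in> {2..N+2}" for k
    by (rule holomorphic_on_mult[OF _ hs[OF that]], intro holomorphic_intros tcoeff_holomorphic) (use that in auto)
  then have "g holomorphic_on ?S"
    unfolding g_def
    by (rule holomorphic_on_add[OF holomorphic_on_add[OF holomorphic_on_const trem_holomorphic(1)]
          holomorphic_on_sum])
  moreover have "g s = (s - 1) * zeta_series s" if s: "Re s > 1" for s
  proof -
    have "tcoeff k s * zeta_series (s + of_nat k - 1) = - (tcoeff (k - 1) s / of_nat k) * h (s + of_nat k - 1)"
      if "k \<in> {2..N+2}" for k
    proof -
      have "h (s + of_nat k - 1) = (s + of_nat k - 1 - 1) * zeta_series (s + of_nat k - 1)"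
        using s that by (intro h(2)) auto
      then show ?thesis using that tcoeff_step[of k s] by simp
    qed
    then show ?thesis unfolding g_def zeta_series_recurrence[OF s, of N] by simp
  qed
  moreover have "{s::complex. Re s > 1 - real (Suc N)} = ?S" by simp
  ultimately show ?case by metis
qed

lemma continuation_entire:
  "\<exists>h. h holomorphic_on UNIV \<and> (\<forall>s. Re s > 1 \<longrightarrow> h s = (s - 1) * zeta_series s)"
proof -
  obtain h where h: "\<And>N. h N holomorphic_on {s. Re s > 1 - real N}"
    "\<And>N s. Re s > 1 \<Longrightarrow> h N s = (s - 1) * zeta_series s"
    using continuation_halfplane by metis
  have eq: "h M z = h N z" if "M \<le> N" "Re z > 1 - real M" for M N z
  proof (rule analytic_continuation_open[where s = "{s. Re s > 1}" and s' = "{s. Re s > 1 - real M}"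
        and f = "h M" and g = "h N" and z = z])
    show "h N holomorphic_on {s. Re s > 1 - real M}"
      by (rule holomorphic_on_subset[OF h(1)[of N]]) (use that in auto)
    show "h M holomorphic_on {s. Re s > 1 - real M}" by (rule h(1))
    show "open {s. Re s > 1}" "open {s. Re s > 1 - real M}"
      by (simp_all add: open_halfspace_Re_gt)
    have "2 \<in> {s. Re s > 1}" by simp
    then show "{s. Re s > 1} \<noteq> {}" by blast
    show "connected {s. Re s > 1 - real M}"
      by (intro convex_connected convex_halfspace_Re_gt)
    show "{s. Re s > 1} \<subseteq> {s. Re s > 1 - real M}" by auto
    show "z \<in> {s. Re s > 1 - real M}" using that by simp
    show "h M s = h N s" if "s \<in> {s. Re s > 1}" for s
    proof -
      from that have "Re s > 1" by simp
      then show ?thesis using h(2)[of s M] h(2)[of s N] by simp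
    qed
  qed
  define H where "H = (\<lambda>s. h (nat \<lceil>\<bar>Re s\<bar>\<rceil> + 2) s)"
  have HN: "H s = h N s" if "Re s > 1 - real N" for s N
  proof -
    define M where "M = nat \<lceil>\<bar>Re s\<bar>\<rceil> + 2"
    have M: "Re s > 1 - real M" unfolding M_def by linarith
    have "h M s = h N s"
    proof (cases "M \<le> N")
      case True
      then show ?thesis using eq M by blast
    next
      case False
      then show ?thesis using eq[of N M s] that by simp
    qed
    then show ?thesis by (simp add: H_def M_def)
  qed
  have "H holomorphic_on {s. Re s > 1 - real N}" for N
    by (rule holomorphic_transform[OF h(1)[of N]]) (simp add: HN)
  then have "H holomorphic_on (\<Union>N. {s. Re s > 1 - real N})"
    by (intro holomorphic_on_UN_open) (auto simp: open_halfspace_Re_gt)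
  moreover have "(\<Union>N. {s. Re s > 1 - real N}) = UNIV"
  proof -
    have "\<exists>N. Re s > 1 - real N" for s
      using reals_Archimedean2[of "1 - Re s"] by (auto simp: algebra_simps)
    then show ?thesis by auto
  qed
  moreover have "H s = (s - 1) * zeta_series s" if "Re s > 1" for s
    using HN[of 0 s] h(2)[of s 0] that by simp
  ultimately show ?thesis by auto
qed

lemma zeta_unique_existence:
  "\<exists>!f. f nicely_meromorphic_on UNIV \<and>
     (\<forall>s. Re s > 1 \<longrightarrow> (\<lambda>n. 1 / of_nat (Suc n) powr s) sums f s)"
proof (rule ex_ex1I)
  obtain h where h: "h holomorphic_on UNIV" "\<And>s. Re s > 1 \<Longrightarrow> h s = (s - 1) * zeta_series s"
    using continuation_entire by blast
  let ?f = "remove_sings (\<lambda>s. h s / (s - 1))"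
  have "h analytic_on UNIV" using h(1) by (simp add: analytic_on_open)
  then have "(\<lambda>s. h s / (s - 1)) meromorphic_on UNIV"
    by (intro meromorphic_intros analytic_on_imp_meromorphic_on) auto
  then have "?f nicely_meromorphic_on UNIV" by (rule remove_sings_nicely_meromorphic)
  moreover have "(\<lambda>n. 1 / of_nat (Suc n) powr s) sums ?f s" if s: "Re s > 1" for s
  proof -
    have "s \<noteq> 1" using s by auto
    then have "(\<lambda>s. h s / (s - 1)) analytic_on {s}"
      using \<open>h analytic_on UNIV\<close> by (intro analytic_intros) (auto elim: analytic_on_subset)
    then have "?f s = h s / (s - 1)" by simp
    also have "\<dots> = zeta_series s" using h(2)[OF s] \<open>s \<noteq> 1\<close> by simp
    finally show ?thesis using zeta_series_sums[OF s] by simp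
  qed
  ultimately show "\<exists>f. f nicely_meromorphic_on UNIV \<and>
     (\<forall>s. Re s > 1 \<longrightarrow> (\<lambda>n. 1 / of_nat (Suc n) powr s) sums f s)" by blast
next
  fix f g :: "complex \<Rightarrow> complex"
  assume f: "f nicely_meromorphic_on UNIV \<and>
     (\<forall>s. Re s > 1 \<longrightarrow> (\<lambda>n. 1 / of_nat (Suc n) powr s) sums f s)"
  assume g: "g nicely_meromorphic_on UNIV \<and>
     (\<forall>s. Re s > 1 \<longrightarrow> (\<lambda>n. 1 / of_nat (Suc n) powr s) sums g s)"
  have eq: "f s = g s" if "Re s > 1" for s
    using f g that sums_unique2 by blast
  have mero: "f meromorphic_on UNIV" "g meromorphic_on UNIV"
    using f g by (auto simp: nicely_meromorphic_on_def)
  have "(\<forall>\<^sub>\<approx>x\<in>UNIV. f x - g x = 0) \<or> (\<forall>\<^sub>\<approx>x\<in>UNIV. f x - g x \<noteq> 0)"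
    by (intro meromorphic_imp_constant_or_avoid meromorphic_intros mero) auto
  moreover have "\<not> (\<forall>\<^sub>\<approx>x\<in>UNIV. f x - g x \<noteq> 0)"
  proof
    assume "\<forall>\<^sub>\<approx>x\<in>UNIV. f x - g x \<noteq> 0"
    then have "eventually (\<lambda>x. f x - g x \<noteq> 0) (at 2)"
      by (rule eventually_cosparse_imp_eventually_at) auto
    moreover have "eventually (\<lambda>x. x \<in> {s. Re s > 1}) (at (2::complex))"
      by (intro eventually_at_in_open') (auto simp: open_halfspace_Re_gt)
    ultimately have "eventually (\<lambda>x. False) (at (2::complex))"
      by eventually_elim (use eq in auto)
    then show False by simp
  qed
  ultimately have ev: "\<forall>\<^sub>\<approx>x\<in>UNIV. f x - g x = 0" by blast
  show "f = g"
  proof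
    fix z
    have ez: "eventually (\<lambda>x. f x = g x) (at z)"
      using eventually_cosparse_imp_eventually_at[OF ev, of z UNIV] by simp
    have "remove_sings f z = remove_sings g z"
      using ez by (rule remove_sings_cong) auto
    moreover have "remove_sings k z = k z" if "k nicely_meromorphic_on UNIV" for k
      using that by (metis UNIV_I nicely_meromorphic_on_def remove_sings_at_pole remove_sings_eqI)
    ultimately show "f z = g z" using f g by simp
  qed
qed

text \<open>
  Throughout, a meromorphic function on the plane is represented by its unique
  \<^const>\<open>nicely_meromorphic_on\<close> representative (removable singularities removed, value 0 at
  poles), so equality of meromorphic functions is equality of HOL functions.
\<close>

definition zeta :: "complex \<Rightarrow> complex" where
  "zeta = (THE f. f nicely_meromorphic_on UNIV \<and>
     (\<forall>s. Re s > 1 \<longrightarrow> (\<lambda>n. 1 / of_nat (Suc n) powr s) sums f s))"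

lemma zeta_nicely_meromorphic: "zeta nicely_meromorphic_on UNIV"
  and zeta_sums: "Re s > 1 \<Longrightarrow> (\<lambda>n. 1 / of_nat (Suc n) powr s) sums zeta s"
  using theI'[OF zeta_unique_existence] unfolding zeta_def by blast+

text \<open>Since \<open>ln 0 = 0\<close>, the definition also gives the correct value at \<open>x = 0\<close>.\<close>

definition log_plus :: "real \<Rightarrow> real" where
  "log_plus x = max 0 (ln x)"

text \<open>At a pole \<^const>\<open>zorder\<close> is minus the multiplicity.\<close>

definition pole_count :: "(complex \<Rightarrow> complex) \<Rightarrow> real \<Rightarrow> real" where
  "pole_count \<phi> r = (\<Sum>z | is_pole \<phi> z \<and> norm z \<le> r. of_int (- zorder \<phi> z))"

definition nevanlinna_N :: "(complex \<Rightarrow> complex) \<Rightarrow> real \<Rightarrow> real" where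
  "nevanlinna_N \<phi> r =
     integral {0..r} (\<lambda>t. (pole_count \<phi> t - pole_count \<phi> 0) / t) + pole_count \<phi> 0 * ln r"

definition nevanlinna_m :: "(complex \<Rightarrow> complex) \<Rightarrow> real \<Rightarrow> real" where
  "nevanlinna_m \<phi> r = 1 / (2 * pi) *
     integral {0..2 * pi} (\<lambda>\<theta>. log_plus (norm (\<phi> (of_real r * exp (\<i> * of_real \<theta>)))))"

definition nevanlinna_T :: "(complex \<Rightarrow> complex) \<Rightarrow> real \<Rightarrow> real" where
  "nevanlinna_T \<phi> r = nevanlinna_N \<phi> r + nevanlinna_m \<phi> r"

text \<open>
  A polynomial in variables indexed by natural numbers, as a finitely supported map from
  exponent vectors to coefficients, the coefficients being functions of one complex variable.
\<close>

type_synonym fun_mpoly = "(nat \<Rightarrow>\<^sub>0 nat) \<Rightarrow>\<^sub>0 (complex \<Rightarrow> complex)"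

definition eval_fun_mpoly :: "fun_mpoly \<Rightarrow> complex \<Rightarrow> (nat \<Rightarrow> complex) \<Rightarrow> complex" where
  "eval_fun_mpoly f s z =
     (\<Sum>\<alpha>\<in>Poly_Mapping.keys f.
        Poly_Mapping.lookup f \<alpha> s * (\<Prod>i\<in>Poly_Mapping.keys \<alpha>. z i ^ Poly_Mapping.lookup \<alpha> i))"

end

theory Submission
  imports Defs
begin

text \<open>
  Each monomial in the \<open>\<zeta>(w + s\<^sub>i)\<close> is, far to the right, a Dirichlet series \<open>\<Sum> a\<^sub>\<alpha>(n) n\<^sup>-\<^sup>w\<close> with
  multiplicative coefficients. Its local factor at a prime \<open>p\<close> determines \<open>\<alpha>\<close> as soon as the numbers
  \<open>p\<^sup>-\<^sup>s\<^sup>i\<close> are distinct, which holds for all but finitely many \<open>p\<close>; hence the \<open>a\<^sub>\<alpha>\<close> are linearly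
  independent over the complex numbers. So if the coefficients \<open>\<phi>\<^sub>\<alpha>\<close> of \<open>f\<close> are not all zero, some
  \<open>g\<^sub>n = \<Sum> a\<^sub>\<alpha>(n) \<phi>\<^sub>\<alpha>\<close> is not identically zero. For the least such \<open>n = N\<close> the equation
  \<open>\<Sum> g\<^sub>n(w) n\<^sup>-\<^sup>w = 0\<close> shows that \<open>g\<^sub>N\<close> is smaller than the \<open>\<phi>\<^sub>\<alpha>\<close> by a factor that decays exponentially in
  the right half-plane. By Jensen's formula this forces \<open>\<Sum> T(r, \<phi>\<^sub>\<alpha>)\<close> to grow at least linearly.
\<close>

section \<open>Euler products with linearly independent coefficients\<close>

definition dirichlet_conv :: "(nat \<Rightarrow> complex) \<Rightarrow> (nat \<Rightarrow> complex) \<Rightarrow> nat \<Rightarrow> complex" where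
  "dirichlet_conv a b n = (\<Sum>d | d dvd n. a d * b (n div d))"

text \<open>Absolute convergence turns the product of the two series into one series over pairs, and
  the bijection from \<open>(n, d)\<close> to \<open>(d, n div d)\<close> groups the pairs by their
  product. The index set \<open>{0<..}\<close> leaves out 0, where the divisor sum is infinite and
  defaults to 0.\<close>

lemma has_sum_dirichlet_conv:
  assumes a: "((\<lambda>n. a n * of_nat n powr (- w)) has_sum F) {0<..}"
    and b: "((\<lambda>n. b n * of_nat n powr (- w)) has_sum G) {0<..}"
  shows "((\<lambda>n. dirichlet_conv a b n * of_nat n powr (- w)) has_sum F * G) {0<..}"
proof -
  define f where "f = (\<lambda>n. a n * of_nat n powr (- w))"
  define g where "g = (\<lambda>n. b n * of_nat n powr (- w))"
  have fs: "(\<lambda>x. norm (f x)) summable_on {0<..}" and gs: "(\<lambda>x. norm (g x)) summable_on {0<..}"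
    using a b unfolding f_def g_def summable_on_iff_abs_summable_on_complex[symmetric]
    by (auto simp: summable_on_def)
  have "(\<lambda>x. norm (case x of (x, y) \<Rightarrow> f x * g y)) summable_on ({0<..} \<times> {0<..})"
    unfolding Infinite_Sum.abs_summable_on_Sigma_iff
    using summable_on_cmult_right[OF gs] summable_on_cmult_left[OF fs]
    by (auto simp: norm_mult infsum_cmult_right' abs_mult infsum_nonneg)
  then have "(\<lambda>(x, y). f x * g y) summable_on ({0<..} \<times> {0<..})"
    by (simp add: summable_on_iff_abs_summable_on_complex)
  then have prod: "((\<lambda>(x, y). f x * g y) has_sum F * G) ({0<..} \<times> {0<..})"
  proof (rule has_sum_SigmaI[rotated 2])
    show "((\<lambda>y. case (x, y) of (x, y) \<Rightarrow> f x * g y) has_sum f x * G) {0<..}" if "x \<in> {0<..}" for x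
      using has_sum_cmult_right[OF b] by (simp add: g_def)
    show "((\<lambda>x. f x * G) has_sum F * G) {0<..}"
      using has_sum_cmult_left[OF a] by (simp add: f_def)
  qed
  have eq: "a d * b (n div d) * of_nat n powr (- w) = f d * g (n div d)" if nd: "n > 0" "d dvd n" for n d
  proof -
    obtain e where e: "n = d * e" using nd(2) by blast
    have "of_nat n powr (- w) = of_nat d powr (- w) * of_nat e powr (- w)"
      unfolding e of_nat_mult by (rule powr_times_real) auto
    moreover have "d > 0" using nd e by (cases d) auto
    ultimately show ?thesis by (simp add: f_def g_def e)
  qed
  have "bij_betw (\<lambda>(n, d). (d, n div d)) (SIGMA n:{0<..}. {d. d dvd n}) ({0<..} \<times> ({0<..} :: nat set))"
  proof (rule bij_betw_byWitness[where f' = "\<lambda>(x, y). (x * y, x)"])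
    show "(\<lambda>(n, d). (d, n div d)) ` (SIGMA n:{0<..}. {d. d dvd n}) \<subseteq> {0<..} \<times> ({0<..} :: nat set)"
      by (auto elim!: dvdE)
  qed auto
  from has_sum_reindex_bij_betw[OF this, of "\<lambda>(x, y). f x * g y"] prod
  have "((\<lambda>(n, d). f d * g (n div d)) has_sum F * G) (SIGMA n:{0<..}. {d. d dvd n})"
    by (simp add: case_prod_unfold)
  then show ?thesis
  proof (rule has_sum_SigmaD)
    fix n :: nat assume n: "n \<in> {0<..}"
    have "((\<lambda>d. f d * g (n div d)) has_sum (\<Sum>d | d dvd n. f d * g (n div d))) {d. d dvd n}"
      using n by (intro has_sum_finite) auto
    also have "(\<Sum>d | d dvd n. f d * g (n div d)) = dirichlet_conv a b n * of_nat n powr (- w)"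
      unfolding dirichlet_conv_def sum_distrib_right using n by (intro sum.cong) (auto simp: eq)
    finally show "((\<lambda>d. case (n, d) of (n, d) \<Rightarrow> f d * g (n div d)) has_sum
        dirichlet_conv a b n * of_nat n powr (- w)) {d. d dvd n}" by simp
  qed
qed

definition multiplicative :: "(nat \<Rightarrow> complex) \<Rightarrow> bool" where
  "multiplicative a \<longleftrightarrow> a 1 = 1 \<and>
     (\<forall>k l. k > 0 \<longrightarrow> l > 0 \<longrightarrow> coprime k l \<longrightarrow> a (k * l) = a k * a l)"

text \<open>For coprime \<open>k\<close> and \<open>l\<close>, each divisor of \<open>k * l\<close>
  splits in exactly one way into a divisor of \<open>k\<close> and a divisor of \<open>l\<close>, so
  the divisor sum factors.\<close>

lemma multiplicative_dirichlet_conv: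
  assumes a: "multiplicative a" and b: "multiplicative b"
  shows "multiplicative (dirichlet_conv a b)"
  unfolding multiplicative_def
proof (intro conjI allI impI)
  have "{d::nat. d dvd 1} = {1}" by auto
  then show "dirichlet_conv a b 1 = 1"
    using a b by (simp add: dirichlet_conv_def multiplicative_def)
next
  fix k l :: nat assume kl: "k > 0" "l > 0" "coprime k l"
  have bij: "bij_betw (\<lambda>(d, e). d * e) ({d. d dvd k} \<times> {e. e dvd l}) {c. c dvd k * l}"
    unfolding bij_betw_def
  proof
    \<comment> \<open>Gcds with \<open>k\<close> and \<open>l\<close> recover the two parts from
      their product, which gives injectivity.\<close>
    have gcds: "gcd (d * e) k = d" "gcd (d * e) l = e" if "d dvd k" "e dvd l" for d e
    proof -
      have "coprime e k" "coprime d l"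
        using kl(3) that by (meson coprime_commute coprime_divisors dvd_refl)+
      then show "gcd (d * e) k = d" "gcd (d * e) l = e"
        using that by (simp_all add: gcd_mult_left_right_cancel gcd_mult_left_left_cancel coprime_commute gcd_proj1_iff)
    qed
    show "inj_on (\<lambda>(d, e). d * e) ({d. d dvd k} \<times> {e. e dvd l})"
    proof (rule inj_onI, clarsimp)
      fix d e d' e' assume "d dvd k" "e dvd l" "d' dvd k" "e' dvd l" "d * e = d' * e'"
      then show "d = d' \<and> e = e'" using gcds[of d e] gcds[of d' e'] by simp
    qed
    show "(\<lambda>(d, e). d * e) ` ({d. d dvd k} \<times> {e. e dvd l}) = {c. c dvd k * l}"
    proof (rule subset_antisym)
      show "{c. c dvd k * l} \<subseteq> (\<lambda>(d, e). d * e) ` ({d. d dvd k} \<times> {e. e dvd l})"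
        by (auto simp: image_iff dest!: division_decomp)
    qed (auto intro: mult_dvd_mono)
  qed
  have "dirichlet_conv a b (k * l) =
      (\<Sum>(d, e)\<in>{d. d dvd k} \<times> {e. e dvd l}. a (d * e) * b ((k * l) div (d * e)))"
    unfolding dirichlet_conv_def sum.reindex_bij_betw[OF bij, symmetric] by (simp add: case_prod_unfold)
  also have "\<dots> = (\<Sum>(d, e)\<in>{d. d dvd k} \<times> {e. e dvd l}. (a d * b (k div d)) * (a e * b (l div e)))"
  proof (rule sum.cong, safe)
    fix d e assume d: "d dvd k" and e: "e dvd l"
    obtain d' e' where k: "k = d * d'" and l: "l = e * e'" using d e by (auto elim!: dvdE)
    then have pos: "d > 0" "e > 0" "d' > 0" "e' > 0" using kl by auto
    have "coprime d e" "coprime d' e'" using kl(3) by (simp_all add: k l)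
    then have "a (d * e) = a d * a e" "b (d' * e') = b d' * b e'"
      using a b pos by (simp_all add: multiplicative_def)
    moreover have "k div d = d'" "l div e = e'" using pos by (simp_all add: k l)
    moreover have "(k * l) div (d * e) = (k div d) * (l div e)"
      using d e by (simp add: div_mult_div_if_dvd)
    ultimately show "a (d * e) * b ((k * l) div (d * e)) = (a d * b (k div d)) * (a e * b (l div e))"
      by simp
  qed
  also have "\<dots> = dirichlet_conv a b k * dirichlet_conv a b l"
    unfolding dirichlet_conv_def sum_product sum.cartesian_product by simp
  finally show "dirichlet_conv a b (k * l) = dirichlet_conv a b k * dirichlet_conv a b l" .
qed

text \<open>The divisors of \<open>p ^ k\<close> are the \<open>p ^ i\<close> with i \<le> k, so on
  the powers of one prime Dirichlet convolution is the Cauchy product.\<close>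

lemma local_series_dirichlet_conv:
  assumes "prime p"
  shows "Abs_fps (\<lambda>k. dirichlet_conv a b (p ^ k)) = Abs_fps (\<lambda>k. a (p ^ k)) * Abs_fps (\<lambda>k. b (p ^ k))"
proof (rule fps_ext)
  fix k
  have p: "p > 1" using assms by (rule prime_gt_1_nat)
  have "{d. d dvd p ^ k} = (\<lambda>i. p ^ i) ` {0..k}"
    using divides_primepow_nat[OF assms] by auto
  moreover have "inj_on (\<lambda>i. p ^ i) {0..k}" using p by (auto intro!: inj_onI)
  ultimately have "dirichlet_conv a b (p ^ k) = (\<Sum>i=0..k. a (p ^ i) * b (p ^ k div p ^ i))"
    by (simp add: dirichlet_conv_def sum.reindex)
  also have "\<dots> = (\<Sum>i=0..k. a (p ^ i) * b (p ^ (k - i)))"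
    using p by (intro sum.cong) (auto simp: power_diff)
  finally show "fps_nth (Abs_fps (\<lambda>k. dirichlet_conv a b (p ^ k))) k =
      fps_nth (Abs_fps (\<lambda>k. a (p ^ k)) * Abs_fps (\<lambda>k. b (p ^ k))) k"
    by (simp add: fps_mult_nth)
qed


section \<open>Euler products of monomials in shifted zeta functions\<close>

text \<open>\<open>Q p\<close> is the reciprocal of the local factor at \<open>p\<close>, as a
  polynomial in the formal variable that stands for \<open>p powr (- w)\<close>. With reciprocals,
  products of series correspond to products of polynomials, and these can be compared through their
  roots. The half-plane of convergence is left existential, so that products need no explicit
  abscissa.\<close>

definition has_euler_product ::
    "(nat \<Rightarrow> complex) \<Rightarrow> (complex \<Rightarrow> complex) \<Rightarrow> (nat \<Rightarrow> complex poly) \<Rightarrow> bool" where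
  "has_euler_product a F Q \<longleftrightarrow> multiplicative a \<and>
     (\<exists>\<sigma>. \<forall>w. Re w > \<sigma> \<longrightarrow> ((\<lambda>n. a n * of_nat n powr (- w)) has_sum F w) {0<..}) \<and>
     (\<forall>p. prime p \<longrightarrow> Abs_fps (\<lambda>k. a (p ^ k)) * fps_of_poly (Q p) = 1)"

lemma has_euler_product_1:
  "has_euler_product (\<lambda>n. if n = 1 then 1 else 0) (\<lambda>w. 1) (\<lambda>p. 1)"
  unfolding has_euler_product_def
proof (intro conjI exI allI impI)
  show "multiplicative (\<lambda>n. if n = 1 then 1 else 0)"
    by (auto simp: multiplicative_def)
  have "((\<lambda>n. (if n = 1 then 1 else 0) * of_nat n powr (- w)) has_sum 1) {1::nat}" for w :: complex
    by (rule has_sum_finiteI) auto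
  then show "((\<lambda>n. (if n = 1 then 1 else 0) * of_nat n powr (- w)) has_sum 1) {0::nat<..}" for w :: complex
    by (rule has_sum_cong_neutral[THEN iffD1, rotated -1]) auto
  fix p :: nat assume "prime p"
  then have "p > 1" by (rule prime_gt_1_nat)
  then have "Abs_fps (\<lambda>k. if p ^ k = 1 then 1 else 0) = (1 :: complex fps)"
    by (intro fps_ext) auto
  then show "Abs_fps (\<lambda>k. if p ^ k = 1 then 1 else 0) * fps_of_poly 1 = (1 :: complex fps)"
    by simp
qed

lemma has_euler_product_mult:
  assumes "has_euler_product a F Q" "has_euler_product b G R"
  shows "has_euler_product (dirichlet_conv a b) (\<lambda>w. F w * G w) (\<lambda>p. Q p * R p)"
  unfolding has_euler_product_def
proof (intro conjI allI impI)
  show "multiplicative (dirichlet_conv a b)"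
    using assms by (intro multiplicative_dirichlet_conv) (auto simp: has_euler_product_def)
  obtain \<sigma> where \<sigma>: "\<And>w. Re w > \<sigma> \<Longrightarrow> ((\<lambda>n. a n * of_nat n powr (- w)) has_sum F w) {0<..}"
    using assms(1) by (auto simp: has_euler_product_def)
  obtain \<tau> where \<tau>: "\<And>w. Re w > \<tau> \<Longrightarrow> ((\<lambda>n. b n * of_nat n powr (- w)) has_sum G w) {0<..}"
    using assms(2) by (auto simp: has_euler_product_def)
  show "\<exists>\<sigma>. \<forall>w. Re w > \<sigma> \<longrightarrow>
      ((\<lambda>n. dirichlet_conv a b n * of_nat n powr (- w)) has_sum F w * G w) {0<..}"
    by (rule exI[of _ "max \<sigma> \<tau>"]) (auto intro: has_sum_dirichlet_conv \<sigma> \<tau>)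
  fix p :: nat assume p: "prime p"
  let ?A = "Abs_fps (\<lambda>k. a (p ^ k))" and ?B = "Abs_fps (\<lambda>k. b (p ^ k))"
  have "(?A * fps_of_poly (Q p)) * (?B * fps_of_poly (R p)) = 1"
    using assms p by (simp add: has_euler_product_def)
  then show "Abs_fps (\<lambda>k. dirichlet_conv a b (p ^ k)) * fps_of_poly (Q p * R p) = 1"
    by (simp add: local_series_dirichlet_conv p fps_of_poly_mult mult_ac)
qed

lemma has_euler_product_prod:
  assumes "finite I" "\<And>i. i \<in> I \<Longrightarrow> \<exists>a. has_euler_product a (F i) (Q i)"
  shows "\<exists>a. has_euler_product a (\<lambda>w. \<Prod>i\<in>I. F i w) (\<lambda>p. \<Prod>i\<in>I. Q i p)"
  using assms
proof (induction I rule: finite_induct)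
  case empty
  show ?case using has_euler_product_1 by auto
next
  case (insert i I)
  obtain a where a: "has_euler_product a (F i) (Q i)"
    using insert.prems by blast
  obtain b where b: "has_euler_product b (\<lambda>w. \<Prod>i\<in>I. F i w) (\<lambda>p. \<Prod>i\<in>I. Q i p)"
    using insert by blast
  from has_euler_product_mult[OF a b] insert.hyps show ?case by auto
qed

lemma has_euler_product_power:
  assumes "has_euler_product a F Q"
  shows "\<exists>a. has_euler_product a (\<lambda>w. F w ^ k) (\<lambda>p. Q p ^ k)"
  using has_euler_product_prod[of "{..<k}" "\<lambda>_. F" "\<lambda>_. Q"] assms by auto

text \<open>The coefficients \<open>n powr (- t)\<close> are completely multiplicative, so the local
  series at \<open>p\<close> is geometric with ratio \<open>p powr (- t)\<close> and its reciprocal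
  is linear.\<close>

lemma has_euler_product_zeta:
  "has_euler_product (\<lambda>n. of_nat n powr (- t)) (\<lambda>w. zeta (w + t)) (\<lambda>p. [:1, - (of_nat p powr (- t)):])"
  unfolding has_euler_product_def
proof (intro conjI exI allI impI)
  have times: "of_nat (k * l) powr (- t) = of_nat k powr (- t) * of_nat l powr (- t)" for k l :: nat
    unfolding of_nat_mult by (rule powr_times_real) auto
  show "multiplicative (\<lambda>n. of_nat n powr (- t))"
    using times by (simp add: multiplicative_def)
  show "((\<lambda>n. of_nat n powr - t * of_nat n powr - w) has_sum zeta (w + t)) {0<..}"
    if w: "Re w > 1 - Re t" for w
  proof -
    have re: "Re (w + t) > 1" using w by simp
    \<comment> \<open>\<open>zeta_sums\<close> is a statement about ordered partial sums; absolute
      convergence upgrades it to \<open>has_sum\<close>, and reindexing by \<open>Suc\<close> moves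
      the sum to \<open>{0<..}\<close>.\<close>
    have "norm (1 / of_nat (Suc n) powr (w + t)) = real (Suc n) powr (- Re (w + t))" for n
      using norm_powr_real_powr[of "of_nat (Suc n)" "w + t"]
      by (simp add: norm_divide powr_minus_divide del: of_nat_Suc plus_complex.sel)
    then have "summable (\<lambda>n. norm (1 / of_nat (Suc n) powr (w + t)))"
      using norm_powr_bound_summable[of "- Re (w + t)"] re by (simp del: of_nat_Suc)
    from norm_summable_imp_has_sum[OF this zeta_sums[OF re]]
    have "((\<lambda>n. 1 / of_nat (Suc n) powr (w + t)) has_sum zeta (w + t)) UNIV" .
    moreover have "bij_betw Suc UNIV {0<..}"
      by (rule bij_betw_byWitness[where f' = "\<lambda>n. n - 1"]) auto
    ultimately have "((\<lambda>n. 1 / of_nat n powr (w + t)) has_sum zeta (w + t)) {0<..}"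
      using has_sum_reindex_bij_betw[of Suc UNIV "{0<..}" "\<lambda>n. 1 / of_nat n powr (w + t)"] by simp
    moreover have "1 / of_nat n powr (w + t) = of_nat n powr - t * of_nat n powr - w" for n
      using powr_minus[of "of_nat n" "w + t"] powr_add[of "of_nat n" "- t" "- w"]
      by (cases "n = 0") (simp_all add: divide_inverse algebra_simps)
    ultimately show ?thesis by simp
  qed
  fix p :: nat assume "prime p"
  have pow: "of_nat (p ^ k) powr (- t) = (of_nat p powr (- t)) ^ k" for k
  proof (induction k)
    case (Suc k)
    then show ?case using times[of p "p ^ k"] by simp
  qed simp
  have "Abs_fps (\<lambda>k. c ^ k) * fps_of_poly [:1, - c:] = 1" for c :: complex
  proof (rule fps_ext)
    fix n show "fps_nth (Abs_fps (\<lambda>k. c ^ k) * fps_of_poly [:1, - c:]) n = fps_nth 1 n"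
      unfolding fps_of_poly_linear' distrib_left
      by (cases n) (simp_all add: mult.left_commute[of "Abs_fps _"] flip: fps_const_neg)
  qed
  then show "Abs_fps (\<lambda>k. of_nat (p ^ k) powr - t) * fps_of_poly [:1, - (of_nat p powr - t):] = 1"
    unfolding pow .
qed

section \<open>Linear independence of the coefficient sequences\<close>

text \<open>The exponent at \<open>j\<close> is the order of the product at
  \<open>inverse (x j)\<close>: since \<open>x\<close> is injective on \<open>I\<close>, no other
  factor vanishes there.\<close>

lemma prod_linear_powers_cancel:
  fixes x :: "'a \<Rightarrow> complex"
  assumes I: "finite I" "inj_on x I" "j \<in> I" and nz: "\<And>i. i \<in> I \<Longrightarrow> x i \<noteq> 0"
    and eq: "(\<Prod>i\<in>I. [:1, - x i:] ^ d i) = (\<Prod>i\<in>I. [:1, - x i:] ^ e i)"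
  shows "d j = e j"
proof -
  have "order (inverse (x j)) (\<Prod>i\<in>I. [:1, - x i:] ^ d i) = d j" for d :: "'a \<Rightarrow> nat"
  proof -
    let ?R = "\<Prod>i\<in>I - {j}. [:1, - x i:] ^ d i"
    have "poly ?R (inverse (x j)) \<noteq> 0"
      using I nz by (auto simp: poly_prod prod_zero_iff field_simps inj_on_def)
    moreover from this have "?R \<noteq> 0" by auto
    moreover have "[:1, - x j:] = smult (- x j) [:- inverse (x j), 1:]"
      using nz[OF I(3)] by simp
    then have "order (inverse (x j)) ([:1, - x j:] ^ d j) = d j"
      using nz[OF I(3)] by (simp only: smult_power) (simp add: order_smult order_power_n_n)
    ultimately show ?thesis
      using prod.remove[OF I(1,3), of "\<lambda>i. [:1, - x i:] ^ d i"]
      by (simp add: order_mult order_0I)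
  qed
  then show ?thesis using eq by metis
qed

text \<open>Two different exponents \<open>u\<close>, \<open>v\<close> collide at no more than one
  prime. A collision at \<open>p\<close> makes \<open>(v - u) * ln p\<close> a nonzero multiple of
  \<open>2 * pi * \<i>\<close>; collisions at \<open>p\<close> and \<open>q\<close> together make
  \<open>ln p\<close> and \<open>ln q\<close> commensurable, hence some positive power of
  \<open>p\<close> equals a power of \<open>q\<close>, and p = q. There are finitely many pairs of
  indices.\<close>

lemma finite_primes_powr_collision:
  assumes "finite I" "inj_on s I"
  shows "finite {p. prime p \<and> \<not> inj_on (\<lambda>i. (of_nat p :: complex) powr (- s i)) I}"
proof -
  have unique: "p = q" if pq: "prime p" "prime q" and uv: "u \<noteq> v"
    and eq: "of_nat p powr (- u) = of_nat p powr (- v)" "of_nat q powr (- u) = of_nat q powr (- v)"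
    for p q :: nat and u v :: complex
  proof -
    have *: "\<exists>n::int. n \<noteq> 0 \<and> (v - u) * of_real (ln (real p)) = of_int n * (2 * pi * \<i>)"
      if "prime p" "of_nat p powr (- u) = of_nat p powr (- v)" for p :: nat
    proof -
      have p: "p > 1" using that(1) by (rule prime_gt_1_nat)
      then have ln: "Ln (of_nat p) = of_real (ln (real p))"
        using Ln_of_real[of "real p"] by simp
      have "exp (- u * of_real (ln (real p))) = exp (- v * of_real (ln (real p)))"
        using that(2) p by (simp add: powr_def ln)
      then obtain n :: int where
        n: "- u * of_real (ln (real p)) = - v * of_real (ln (real p)) + (of_int (2 * n) * pi) * \<i>"
        unfolding exp_eq by blast
      then have "(v - u) * of_real (ln (real p)) = of_int n * (2 * pi * \<i>)"
        by (simp add: algebra_simps)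
      moreover from this have "n \<noteq> 0" using uv p by auto
      ultimately show ?thesis by blast
    qed
    obtain n k :: int where n: "n \<noteq> 0" "(v - u) * of_real (ln (real p)) = of_int n * (2 * pi * \<i>)"
      and k: "k \<noteq> 0" "(v - u) * of_real (ln (real q)) = of_int k * (2 * pi * \<i>)"
      using *[OF pq(1) eq(1)] *[OF pq(2) eq(2)] by blast
    have "(v - u) * (of_int k * of_real (ln (real p))) = (v - u) * (of_int n * of_real (ln (real q)))"
      using n(2) k(2) by (metis mult.left_commute)
    then have "of_int k * of_real (ln (real p)) = (of_int n * of_real (ln (real q)) :: complex)"
      using uv by simp
    then have "of_real (of_int k * ln (real p)) = (of_real (of_int n * ln (real q)) :: complex)"
      by simp
    then have "of_int k * ln (real p) = of_int n * ln (real q)"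
      by (simp only: of_real_eq_iff)
    then have "\<bar>of_int k * ln (real p)\<bar> = \<bar>of_int n * ln (real q)\<bar>" by simp
    moreover have p1: "p > 1" "q > 1" using pq by (auto dest: prime_gt_1_nat)
    ultimately have "real (nat \<bar>k\<bar>) * ln (real p) = real (nat \<bar>n\<bar>) * ln (real q)"
      by (simp add: abs_mult)
    then have "ln (real (p ^ nat \<bar>k\<bar>)) = ln (real (q ^ nat \<bar>n\<bar>))"
      using p1 by (simp add: ln_realpow)
    then have "real (p ^ nat \<bar>k\<bar>) = real (q ^ nat \<bar>n\<bar>)"
      using p1 by (subst (asm) ln_inj_iff) auto
    then have "p ^ nat \<bar>k\<bar> = q ^ nat \<bar>n\<bar>" by (simp only: of_nat_eq_iff)
    moreover have "p dvd p ^ nat \<bar>k\<bar>" using k(1) by (simp add: dvd_power)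
    ultimately have "p dvd q" using pq(1) prime_dvd_power by metis
    then show ?thesis using pq by (simp add: primes_dvd_imp_eq)
  qed
  have "finite {p. prime p \<and> (of_nat p :: complex) powr (- s i) = of_nat p powr (- s j)}"
    if "s i \<noteq> s j" for i j
  proof -
    have "\<exists>q. {p. prime p \<and> (of_nat p :: complex) powr (- s i) = of_nat p powr (- s j)} \<subseteq> {q}"
      using unique that by blast
    then show ?thesis using finite_subset by blast
  qed
  then have "finite (\<Union>(i, j)\<in>{(i, j)\<in>I \<times> I. i \<noteq> j}.
      {p. prime p \<and> (of_nat p :: complex) powr (- s i) = of_nat p powr (- s j)})"
    using assms by (intro finite_UN_I) (auto simp: inj_on_def intro: finite_subset[of _ "I \<times> I"])
  then show ?thesis
    by (rule finite_subset[rotated]) (auto simp: inj_on_def)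
qed

text \<open>This follows the proof that distinct characters are independent. Comparing the relation
  at \<open>p ^ k * n\<close> with \<open>a j (p ^ k)\<close> times the relation at \<open>n\<close>
  removes the index \<open>j\<close>. Multiplicativity needs \<open>p\<close> and \<open>n\<close>
  coprime, so the shorter relation holds only for \<open>n\<close> prime to \<open>p\<close>; the
  finite set \<open>S\<close> of excluded primes makes the statement strong enough for this
  induction.\<close>

lemma multiplicative_independent:
  fixes a :: "'b \<Rightarrow> nat \<Rightarrow> complex"
  assumes "finite I" "\<And>i. i \<in> I \<Longrightarrow> multiplicative (a i)"
    and "\<And>i j. i \<in> I \<Longrightarrow> j \<in> I \<Longrightarrow> i \<noteq> j \<Longrightarrow>
      infinite {p. prime p \<and> (\<exists>k. a i (p ^ k) \<noteq> a j (p ^ k))}"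
    and "finite S" "S \<subseteq> {p. prime p}"
    and "\<And>n. n > 0 \<Longrightarrow> (\<forall>p\<in>S. \<not> p dvd n) \<Longrightarrow> (\<Sum>i\<in>I. c i * a i n) = 0"
  shows "\<forall>i\<in>I. c i = 0"
  using assms
proof (induction I arbitrary: c S rule: finite_induct)
  case (insert j I)
  have one: "a i 1 = 1" if "i \<in> insert j I" for i
    using insert.prems(1)[OF that] by (simp add: multiplicative_def)
  have step: "c i * (a i (p ^ k) - a j (p ^ k)) = 0" if p: "prime p" "p \<notin> S" and i: "i \<in> I" for p k i
  proof -
    have "\<forall>i\<in>I. c i * (a i (p ^ k) - a j (p ^ k)) = 0"
    proof (rule insert.IH[where S = "insert p S"])
      show "insert p S \<subseteq> {p. prime p}" "finite (insert p S)"
        using p insert.prems(3,4) by auto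
      fix n :: nat assume n: "n > 0" "\<forall>q\<in>insert p S. \<not> q dvd n"
      have cop: "coprime (p ^ k) n" using n p by (simp add: prime_imp_coprime)
      have pk: "p ^ k > 0" using p(1) by (simp add: prime_gt_0_nat)
      have mul: "a i (p ^ k * n) = a i (p ^ k) * a i n" if "i \<in> insert j I" for i
        using insert.prems(1)[OF that] cop n(1) pk unfolding multiplicative_def by blast
      have "\<not> q dvd p ^ k * n" if "q \<in> S" for q
      proof
        assume "q dvd p ^ k * n"
        moreover have q: "prime q" using that insert.prems(4) by auto
        ultimately have "q dvd p" using n that by (metis insertCI prime_dvd_mult_iff prime_dvd_power)
        then show False using q p that by (metis primes_dvd_imp_eq)
      qed
      \<comment> \<open>Both relations are available because \<open>p ^ k * n\<close> is still
        divisible by no prime of \<open>S\<close>. The term with i = j cancels in the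
        difference.\<close>
      then have "0 = (\<Sum>i\<in>insert j I. c i * a i (p ^ k * n)) - a j (p ^ k) * (\<Sum>i\<in>insert j I. c i * a i n)"
        using insert.prems(5)[of n] insert.prems(5)[of "p ^ k * n"] n pk by simp
      also have "\<dots> = (\<Sum>i\<in>insert j I. c i * (a i (p ^ k) - a j (p ^ k)) * a i n)"
        unfolding sum_distrib_left sum_subtractf[symmetric]
        by (intro sum.cong refl, subst mul) (simp_all add: algebra_simps)
      finally show "(\<Sum>i\<in>I. c i * (a i (p ^ k) - a j (p ^ k)) * a i n) = 0"
        using insert.hyps by simp
    qed (use insert.prems in auto)
    then show ?thesis using i by blast
  qed
  \<comment> \<open>Infinitely many primes separate \<open>a i\<close> from \<open>a j\<close>, so
    one of them lies outside \<open>S\<close>. Once the other coefficients are known to vanish, the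
    relation at 1 gives \<open>c j = 0\<close>.\<close>
  have I: "c i = 0" if "i \<in> I" for i
  proof -
    have "infinite ({p. prime p \<and> (\<exists>k. a i (p ^ k) \<noteq> a j (p ^ k))} - S)"
      using insert.prems(2)[of i j] insert.prems(3) insert.hyps that by auto
    then have "{p. prime p \<and> (\<exists>k. a i (p ^ k) \<noteq> a j (p ^ k))} - S \<noteq> {}"
      by (rule infinite_imp_nonempty)
    then obtain p k where "prime p" "p \<notin> S" "a i (p ^ k) \<noteq> a j (p ^ k)" by blast
    then show ?thesis using step[of p i k] that by simp
  qed
  moreover have "(\<Sum>i\<in>insert j I. c i * a i 1) = 0"
    using insert.prems(4) by (intro insert.prems(5)) auto
  then have "c j = 0" using I one insert.hyps by simp
  ultimately show ?case by auto
qed simp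

text \<open>At every prime where the numbers \<open>p powr (- s i)\<close> are distinct, the
  reciprocal local factor determines the exponent vector; only finitely many primes fail this, so
  \<open>multiplicative_independent\<close> applies. The independence is over constants, to be used
  with the values of the coefficients of the polynomial at a single point.\<close>

lemma zeta_shift_monomials_independent:
  fixes s :: "nat \<Rightarrow> complex" and A :: "(nat \<Rightarrow>\<^sub>0 nat) set"
  assumes inj: "inj_on s {..m}" and A: "finite A" "\<And>\<alpha>. \<alpha> \<in> A \<Longrightarrow> Poly_Mapping.keys \<alpha> \<subseteq> {..m}"
  shows "\<exists>a \<sigma>. (\<forall>\<alpha>\<in>A. \<forall>w. Re w > \<sigma> \<longrightarrow>
      ((\<lambda>n. a \<alpha> n * of_nat n powr (- w)) has_sum
        (\<Prod>i\<in>Poly_Mapping.keys \<alpha>. zeta (w + s i) ^ Poly_Mapping.lookup \<alpha> i)) {0<..}) \<and>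
    (\<forall>c. (\<forall>n>0. (\<Sum>\<alpha>\<in>A. c \<alpha> * a \<alpha> n) = 0) \<longrightarrow> (\<forall>\<alpha>\<in>A. c \<alpha> = 0))"
proof -
  \<comment> \<open>The products run over \<open>{..m}\<close> instead of the keys, so that the
    polynomials \<open>Q\<close> for different exponent vectors share one index set; exponent 0
    contributes the factor 1.\<close>
  define F where "F = (\<lambda>\<alpha> w. \<Prod>i\<in>{..m}. zeta (w + s i) ^ Poly_Mapping.lookup \<alpha> i)"
  define Q where "Q = (\<lambda>\<alpha> p. \<Prod>i\<in>{..m}. [:1, - (of_nat p powr (- s i)):] ^ Poly_Mapping.lookup \<alpha> i :: complex poly)"
  have "\<exists>a. has_euler_product a (F \<alpha>) (Q \<alpha>)" for \<alpha>
    unfolding F_def Q_def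
    by (intro has_euler_product_prod has_euler_product_power[OF has_euler_product_zeta]) auto
  then obtain a where a: "\<And>\<alpha>. has_euler_product (a \<alpha>) (F \<alpha>) (Q \<alpha>)" by metis
  then obtain \<sigma> where \<sigma>: "\<And>\<alpha> w. Re w > \<sigma> \<alpha> \<Longrightarrow>
      ((\<lambda>n. a \<alpha> n * of_nat n powr (- w)) has_sum F \<alpha> w) {0<..}"
    unfolding has_euler_product_def by metis
  have F: "F \<alpha> w = (\<Prod>i\<in>Poly_Mapping.keys \<alpha>. zeta (w + s i) ^ Poly_Mapping.lookup \<alpha> i)" if "\<alpha> \<in> A" for \<alpha> w
    unfolding F_def by (rule prod.mono_neutral_right) (use A(2)[OF that] in \<open>auto simp: in_keys_iff\<close>)
  have inf: "infinite {p. prime p \<and> (\<exists>k. a \<alpha> (p ^ k) \<noteq> a \<beta> (p ^ k))}"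
    if "\<alpha> \<in> A" "\<beta> \<in> A" "\<alpha> \<noteq> \<beta>" for \<alpha> \<beta>
  proof -
    have "infinite ({p::nat. prime p} - {p. prime p \<and> \<not> inj_on (\<lambda>i. (of_nat p :: complex) powr (- s i)) {..m}})"
      using primes_infinite finite_primes_powr_collision[OF _ inj] by auto
    moreover have "\<exists>k. a \<alpha> (p ^ k) \<noteq> a \<beta> (p ^ k)"
      if p: "prime p" and inj_p: "inj_on (\<lambda>i. (of_nat p :: complex) powr (- s i)) {..m}" for p
    proof (rule ccontr)
      assume "\<not> ?thesis"
      \<comment> \<open>Equal local series have equal reciprocals, so the polynomials agree and with
        them the exponents up to \<open>m\<close>; beyond \<open>m\<close> both exponents are
        0.\<close>
      then have "Abs_fps (\<lambda>k. a \<alpha> (p ^ k)) = Abs_fps (\<lambda>k. a \<beta> (p ^ k))" by simp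
      moreover have "Abs_fps (\<lambda>k. a \<gamma> (p ^ k)) * fps_of_poly (Q \<gamma> p) = 1" for \<gamma>
        using a[of \<gamma>] p by (simp add: has_euler_product_def)
      ultimately have "Abs_fps (\<lambda>k. a \<alpha> (p ^ k)) * fps_of_poly (Q \<alpha> p) =
          Abs_fps (\<lambda>k. a \<alpha> (p ^ k)) * fps_of_poly (Q \<beta> p)" "Abs_fps (\<lambda>k. a \<alpha> (p ^ k)) \<noteq> 0"
        by (metis, metis mult_zero_left zero_neq_one)
      then have Q: "Q \<alpha> p = Q \<beta> p" by simp
      have "Poly_Mapping.lookup \<alpha> i = Poly_Mapping.lookup \<beta> i" if "i \<le> m" for i
        by (rule prod_linear_powers_cancel[OF _ inj_p _ _ Q[unfolded Q_def]])
          (use that p in \<open>auto dest: prime_gt_0_nat\<close>)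
      moreover have "Poly_Mapping.lookup \<alpha> i = Poly_Mapping.lookup \<beta> i" if "\<not> i \<le> m" for i
        using A(2)[OF \<open>\<alpha> \<in> A\<close>] A(2)[OF \<open>\<beta> \<in> A\<close>] that by (metis atMost_iff in_keys_iff subsetD)
      ultimately have "\<alpha> = \<beta>" by (intro poly_mapping_eqI) blast
      then show False using \<open>\<alpha> \<noteq> \<beta>\<close> by simp
    qed
    ultimately show ?thesis
      by (elim contrapos_nn) (auto elim: finite_subset[rotated])
  qed
  have "\<forall>\<alpha>\<in>A. c \<alpha> = 0" if "\<forall>n>0. (\<Sum>\<alpha>\<in>A. c \<alpha> * a \<alpha> n) = 0" for c
    by (rule multiplicative_independent[OF A(1) _ inf, where S = "{}"])
      (use a that in \<open>auto simp: has_euler_product_def\<close>)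
  moreover have "((\<lambda>n. a \<alpha> n * of_nat n powr (- w)) has_sum
        (\<Prod>i\<in>Poly_Mapping.keys \<alpha>. zeta (w + s i) ^ Poly_Mapping.lookup \<alpha> i)) {0<..}"
    if "\<alpha> \<in> A" "Re w > Max (insert 0 (\<sigma> ` A))" for \<alpha> w
    using \<sigma>[of \<alpha> w] F[OF that(1), of w] that A(1) by auto
  ultimately show ?thesis by blast
qed

section \<open>Jensen's formula\<close>

lemma ln_power_int:
  fixes x :: real
  assumes "x > 0"
  shows "ln (x powi k) = of_int k * ln x"
  using assms powr_real_of_int'[of x k] ln_powr[of x "of_int k"] by simp

text \<open>On the disc \<open>h\<close> is the exponential of a holomorphic \<open>g\<close>, so
  \<open>ln (norm (h z))\<close> is the real part of \<open>g\<close> and Cauchy's formula at the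
  centre is the mean value property.\<close>

lemma mean_ln_norm_nonvanishing:
  assumes h: "h holomorphic_on ball 0 R" "\<And>z. z \<in> ball 0 R \<Longrightarrow> h z \<noteq> 0" and r: "0 < r" "r < R"
  shows "((\<lambda>\<theta>. ln (norm (h (of_real r * exp (\<i> * of_real \<theta>))))) has_integral
    2 * pi * ln (norm (h 0))) {0..2 * pi}"
proof -
  have 0: "0 \<in> ball 0 R" using r by simp
  obtain g where g: "g holomorphic_on ball 0 R" and exp_g: "\<And>z. z \<in> ball 0 R \<Longrightarrow> exp (g z) = h z"
    using holomorphic_logarithm_exists[OF convex_ball open_ball h 0] by metis
  have Re_g: "ln (norm (h z)) = Re (g z)" if "z \<in> ball 0 R" for z
    using exp_g[OF that] by (metis norm_exp_eq_Re ln_exp)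
  have "((\<lambda>u. g u / (u - 0)) has_contour_integral (2 * of_real pi * \<i> * g 0)) (circlepath 0 r)"
  proof (rule Cauchy_integral_circlepath_simple)
    show "g holomorphic_on cball 0 r" by (rule holomorphic_on_subset[OF g]) (use r in auto)
  qed (use r in auto)
  then have "((\<lambda>t. g (0 + of_real r * cis t) / (0 + of_real r * cis t - 0) * of_real r * \<i> * cis t)
      has_integral (2 * of_real pi * \<i> * g 0)) {0..2 * pi}"
    unfolding circlepath_def by (subst (asm) has_contour_integral_part_circlepath_iff) auto
  then have "((\<lambda>t. g (of_real r * cis t) * \<i>) has_integral (2 * of_real pi * \<i> * g 0)) {0..2 * pi}"
    using r by (simp add: field_simps)
  \<comment> \<open>The integrand still carries the factor \<i>, so its imaginary part is the real
    part of \<open>g\<close>.\<close>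
  from has_integral_linear[OF this bounded_linear_Im]
  have "((\<lambda>t. Re (g (of_real r * cis t))) has_integral (2 * pi * Re (g 0))) {0..2 * pi}"
    by (simp add: o_def)
  then show ?thesis
    using r by (simp add: Re_g[OF 0] Re_g norm_mult cis_conv_exp)
qed

text \<open>A pole would make the order negative and a zero would make it positive, so the
  singularity is removable with a nonzero limit.\<close>

lemma remove_sings_analytic_nonzero:
  assumes f: "f meromorphic_on {z}" "eventually (\<lambda>w. f w \<noteq> 0) (at z)" "zorder f z = 0"
  shows "remove_sings f analytic_on {z}" "remove_sings f z \<noteq> 0"
proof -
  have iso: "isolated_singularity_at f z" and ness: "not_essential f z"
    using f(1) by (simp_all add: meromorphic_at_iff)
  have np: "\<not> is_pole f z" using isolated_pole_imp_neg_zorder[OF iso] f(3) by auto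
  then obtain c where "f \<midarrow>z\<rightarrow> c" using ness by (auto simp: not_essential_def)
  then show "remove_sings f analytic_on {z}" by (rule remove_sings_analytic_at[OF iso])
  have "\<not> f \<midarrow>z\<rightarrow> 0"
    using zorder_isolated_zero_pos'[OF _ iso] f(2,3) by (auto simp: isolated_zero_def)
  then show "remove_sings f z \<noteq> 0" using remove_sings_eq_0_iff[OF ness] np by blast
qed

section \<open>Blaschke factors and Jensen's formula\<close>

text \<open>This is the contribution of a simple pole at \<open>w\<close> to the counting function
  at radius \<open>r\<close>: the integral of 1/t from \<open>norm w\<close> to \<open>r\<close>, or
  the separate term \<open>ln r\<close> if the pole is the origin.\<close>

definition disc_weight :: "real \<Rightarrow> complex \<Rightarrow> real" where
  "disc_weight r w = (if w = 0 then ln r else ln (r / norm w))"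

lemma disc_weight_nonneg: "r \<ge> 1 \<Longrightarrow> norm w \<le> r \<Longrightarrow> disc_weight r w \<ge> 0"
  by (auto simp: disc_weight_def)

text \<open>The Blaschke factor of the disc of radius \<open>r\<close> with its zero at
  \<open>w\<close>. Multiplying by its powers changes orders inside the disc without changing the
  modulus on the circle.\<close>

definition blaschke :: "real \<Rightarrow> complex \<Rightarrow> complex \<Rightarrow> complex" where
  "blaschke r w z = of_real r * (z - w) / (of_real (r\<^sup>2) - cnj w * z)"

text \<open>On the circle \<open>r\<^sup>2 = z * cnj z\<close>, so the denominator is
  \<open>z * cnj (z - w)\<close>.\<close>

lemma norm_blaschke:
  assumes "norm z = r" "norm w < r"
  shows "norm (blaschke r w z) = 1"
proof -
  have "of_real (r\<^sup>2) - cnj w * z = z * cnj (z - w)"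
    using assms(1) complex_norm_square[of z] by (simp add: algebra_simps)
  then have "norm (of_real (r\<^sup>2) - cnj w * z) = r * norm (z - w)"
    using assms(1) by (simp only: norm_mult complex_mod_cnj)
  moreover have "z \<noteq> w" "r > 0" using assms norm_ge_zero[of w] by auto
  ultimately show ?thesis by (simp add: blaschke_def norm_divide norm_mult)
qed

text \<open>Dividing \<open>g\<close> by Blaschke factors to the powers of its orders leaves a
  function without zeros or poles near the closed disc and with the same modulus on the circle. The
  mean value property applies to it, and its value at 0 gives the right-hand side. \<open>Z\<close>
  may contain points of order 0; it contains 0 so that the leading Laurent coefficient there always
  appears in the same form.\<close>

lemma jensen_formula:
  assumes g: "g meromorphic_on UNIV" and r: "r > 0"
    and Z: "finite Z" "Z \<subseteq> ball 0 r" "0 \<in> Z"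
    and good: "\<And>z. norm z \<le> r \<Longrightarrow> z \<notin> Z \<Longrightarrow> g analytic_on {z} \<and> g z \<noteq> 0"
  shows "((\<lambda>\<theta>. ln (norm (g (of_real r * exp (\<i> * of_real \<theta>))))) has_integral
    2 * pi * (ln (norm (zor_poly g 0 0)) + (\<Sum>w\<in>Z. of_int (zorder g w) * disc_weight r w))) {0..2 * pi}"
proof -
  have mero: "g meromorphic_on A" for A using g by (rule meromorphic_on_subset) auto
  have "of_real r \<notin> Z" "norm (of_real r :: complex) \<le> r" using Z r by auto
  then have gr: "g analytic_on {of_real r}" "g (of_real r) \<noteq> 0" using good by auto
  have "(\<forall>\<^sub>\<approx>z\<in>UNIV. g z = 0) \<or> (\<forall>\<^sub>\<approx>z\<in>UNIV. g z \<noteq> 0)"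
    by (rule meromorphic_imp_constant_or_avoid[OF g]) auto
  moreover have "\<not> (\<forall>\<^sub>\<approx>z\<in>UNIV. g z = 0)"
  proof
    assume "\<forall>\<^sub>\<approx>z\<in>UNIV. g z = 0"
    then have "eventually (\<lambda>z. g z = 0) (at (of_real r))"
      by (rule eventually_cosparse_imp_eventually_at) auto
    with analytic_at_neq_imp_eventually_neq[OF gr] have "eventually (\<lambda>z. False) (at (of_real r :: complex))"
      by eventually_elim auto
    then show False by simp
  qed
  ultimately have cosparse: "\<forall>\<^sub>\<approx>z\<in>UNIV. g z \<noteq> 0" by blast
  then have g_nz: "eventually (\<lambda>z. g z \<noteq> 0) (at v)" for v
    by (rule eventually_cosparse_imp_eventually_at) auto
  define X where "X = {z. \<not> (g analytic_on {z} \<and> g z \<noteq> 0)} - Z"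
  have "\<forall>\<^sub>\<approx>z\<in>UNIV. g analytic_on {z} \<and> g z \<noteq> 0"
    by (intro eventually_conj cosparse meromorphic_on_imp_analytic_cosparse g)
  then have "X sparse_in UNIV"
    unfolding X_def eventually_cosparse by (rule sparse_in_subset2) auto
  then have "closed X" by (rule sparse_in_UNIV_imp_closed)
  \<comment> \<open>An open neighbourhood of the closed disc on which \<open>g\<close> is analytic
    and nonzero off \<open>Z\<close> and no Blaschke denominator vanishes. By compactness it
    contains a slightly larger disc.\<close>
  define V where "V = - X \<inter> (\<Inter>w\<in>Z. {z. of_real (r\<^sup>2) - cnj w * z \<noteq> 0})"
  have "open V"
    unfolding V_def using \<open>closed X\<close> Z(1)
    by (intro open_Int open_INT ballI open_Collect_neq continuous_intros) auto
  moreover have "cball 0 r \<subseteq> V"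
  proof
    fix z :: complex assume z: "z \<in> cball 0 r"
    have "of_real (r\<^sup>2) \<noteq> cnj w * z" if "w \<in> Z" for w
    proof
      assume "of_real (r\<^sup>2) = cnj w * z"
      then have "norm (of_real (r\<^sup>2) :: complex) = norm w * norm z" by (simp add: norm_mult)
      then have "r * r = norm w * norm z" by (simp add: power2_eq_square norm_mult)
      moreover have "norm w < r" "norm z \<le> r" using that Z z by auto
      then have "norm w * norm z \<le> norm w * r" "norm w * r < r * r"
        using r by (auto intro: mult_left_mono)
      ultimately show False by linarith
    qed
    then show "z \<in> V" using good z by (auto simp: V_def X_def)
  qed
  ultimately obtain \<epsilon> where \<epsilon>: "\<epsilon> > 0" "(\<Union>x\<in>cball 0 r. ball x \<epsilon>) \<subseteq> V"
    using compact_subset_open_imp_ball_epsilon_subset[OF compact_cball] by metis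
  have ballV: "z \<in> V" if "z \<in> ball 0 (r + \<epsilon>)" for z
  proof (cases "norm z \<le> r")
    case True
    then show ?thesis using \<open>cball 0 r \<subseteq> V\<close> by auto
  next
    case False
    \<comment> \<open>The radial projection of \<open>z\<close> to the circle, at distance
      \<open>norm z - r\<close> from \<open>z\<close>.\<close>
    define x where "x = of_real (r / norm z) * z"
    have "z - x = of_real (1 - r / norm z) * z" by (simp add: x_def algebra_simps)
    then have "dist z x = \<bar>1 - r / norm z\<bar> * norm z"
      unfolding dist_norm by (simp only: norm_mult norm_of_real)
    also have "\<dots> = norm z - r"
    proof -
      have "norm z > 0" "r / norm z \<le> 1" using False r by (auto simp: divide_le_eq_1)
      then show ?thesis by (simp add: abs_of_nonneg left_diff_distrib)
    qed
    finally have "dist z x = norm z - r" .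
    moreover have "norm x = r" using False r by (auto simp: x_def norm_mult norm_divide)
    ultimately have "x \<in> cball 0 r" "z \<in> ball x \<epsilon>" using that by (auto simp: dist_commute)
    then show ?thesis using \<epsilon>(2) by blast
  qed
  have B_an: "blaschke r w analytic_on {v}" if "w \<in> Z" "v \<in> V" for w v
    unfolding blaschke_def using that by (intro analytic_intros) (auto simp: V_def)
  then have B_mero: "blaschke r w meromorphic_on {v}" if "w \<in> Z" "v \<in> V" for w v
    using that by (intro analytic_on_imp_meromorphic_on) auto
  have B_0: "blaschke r w v = 0 \<longleftrightarrow> v = w" if "w \<in> Z" "v \<in> V" for w v
    using that r by (auto simp: blaschke_def V_def)
  have B_nz: "eventually (\<lambda>z. blaschke r w z \<noteq> 0) (at v)" if "w \<in> Z" "v \<in> V" for w v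
  proof -
    have "eventually (\<lambda>z. z \<in> V - {w}) (at v)"
      using \<open>open V\<close> that by (intro eventually_conj[THEN eventually_mono, OF eventually_at_in_open'[of V] eventually_neq_at_within[of w]]) auto
    then show ?thesis by eventually_elim (use B_0 that in auto)
  qed
  have zorder_B: "zorder (blaschke r w) v = (if v = w then 1 else 0)" if "w \<in> Z" "v \<in> V" for w v
  proof (cases "v = w")
    case True
    define q where "q = (\<lambda>z. of_real r / (of_real (r\<^sup>2) - cnj w * z))"
    have "zorder (blaschke r w) v = 1"
    proof (rule zorder_eqI[of V])
      show "q holomorphic_on V" unfolding q_def by (intro holomorphic_intros) (use that in \<open>auto simp: V_def\<close>)
      show "q v \<noteq> 0" using r that by (auto simp: q_def V_def)
    qed (use that True \<open>open V\<close> in \<open>auto simp: q_def blaschke_def\<close>)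
    then show ?thesis using True by simp
  next
    case False
    then show ?thesis using zorder_eq_0I[OF B_an[OF that]] B_0[OF that] by simp
  qed
  define P where "P = (\<lambda>z. \<Prod>w\<in>Z. blaschke r w z powi (- zorder g w))"
  \<comment> \<open>The order of \<open>P\<close> at each point of \<open>V\<close> is minus that of
    \<open>g\<close>, so \<open>H\<close> has order 0 throughout \<open>V\<close>.\<close>
  define H where "H = (\<lambda>z. g z * P z)"
  have P_mero: "P meromorphic_on {v}" if "v \<in> V" for v
    unfolding P_def using that by (intro meromorphic_intros B_mero)
  have P_nz: "eventually (\<lambda>z. P z \<noteq> 0) (at v)" if "v \<in> V" for v
  proof -
    have "eventually (\<lambda>z. \<forall>w\<in>Z. blaschke r w z \<noteq> 0) (at v)"
      using B_nz that Z(1) by (intro eventually_ball_finite) auto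
    then show ?thesis by eventually_elim (use Z(1) in \<open>auto simp: P_def\<close>)
  qed
  have H_mero: "H meromorphic_on {v}" if "v \<in> V" for v
    unfolding H_def using P_mero[OF that] mero by (intro meromorphic_intros)
  have H_nz: "eventually (\<lambda>z. H z \<noteq> 0) (at v)" if "v \<in> V" for v
    using g_nz[of v] P_nz[OF that] by eventually_elim (auto simp: H_def)
  have zorder_H: "zorder H v = 0" if v: "v \<in> V" for v
  proof -
    have "zorder P v = (\<Sum>w\<in>Z. zorder (\<lambda>z. blaschke r w z powi (- zorder g w)) v)"
      unfolding P_def
      by (rule zorder_prod) (use v P_nz[OF v] in \<open>auto simp: P_def intro!: meromorphic_intros B_mero\<close>)
    also have "\<dots> = (\<Sum>w\<in>Z. if v = w then - zorder g w else 0)"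
      using v B_mero B_nz
      by (intro sum.cong refl, subst zorder_power_int) (auto simp: zorder_B intro!: eventually_frequently)
    also have "\<dots> = (if v \<in> Z then - zorder g v else 0)" using Z(1) by simp
    also have "\<dots> = - zorder g v"
      using v zorder_eq_0I[of g v] by (auto simp: V_def X_def)
    finally show ?thesis
      unfolding H_def using v mero P_mero g_nz P_nz
      by (subst zorder_mult) (auto intro: eventually_frequently)
  qed
  define h where "h = remove_sings H"
  have h_an: "h analytic_on {v}" and h_nz: "h v \<noteq> 0" if "v \<in> V" for v
    using remove_sings_analytic_nonzero[OF H_mero H_nz zorder_H] that by (auto simp: h_def)
  have mean: "((\<lambda>\<theta>. ln (norm (h (of_real r * exp (\<i> * of_real \<theta>))))) has_integral
    2 * pi * ln (norm (h 0))) {0..2 * pi}"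
  proof (rule mean_ln_norm_nonvanishing)
    show "h holomorphic_on ball 0 (r + \<epsilon>)"
      using h_an ballV by (intro analytic_imp_holomorphic analytic_on_analytic_at[THEN iffD2]) auto
  qed (use h_nz ballV r \<epsilon> in auto)
  have circle: "norm (h z) = norm (g z)" if z: "norm z = r" for z
  proof -
    have zV: "z \<in> V" "z \<notin> Z" using z \<open>cball 0 r \<subseteq> V\<close> Z(2) by auto
    have "H analytic_on {z}"
      unfolding H_def P_def using zV good[of z] z B_an B_0
      by (intro analytic_intros) auto
    then have "h z = H z" by (simp add: h_def)
    moreover have "norm (P z) = 1"
      using Z(2) norm_blaschke[OF z] by (auto simp: P_def norm_power_int simp flip: prod_norm intro!: prod.neutral)
    ultimately show ?thesis by (simp add: H_def norm_mult)
  qed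
  define c where "c = zor_poly g 0 0"
  define k where "k = zorder g 0"
  \<comment> \<open>The factor at 0 is kept apart: \<open>blaschke r 0 z\<close> is z/r, so its
    power \<open>- k\<close> combines with the \<open>z powi k\<close> of the Laurent expansion into
    the constant \<open>r powi k\<close>. The value of \<open>h\<close> at 0 is then a limit of
    explicit factors.\<close>
  define P' where "P' = (\<lambda>z. \<Prod>w\<in>Z - {0}. blaschke r w z powi (- zorder g w))"
  have 0: "0 \<in> V" using \<open>cball 0 r \<subseteq> V\<close> r by auto
  have zp: "c \<noteq> 0" "\<exists>s>0. zor_poly g 0 holomorphic_on cball 0 s \<and>
      (\<forall>w\<in>cball 0 s - {0}. g w = zor_poly g 0 w * (w - 0) powi k \<and> zor_poly g 0 w \<noteq> 0)"
    using zorder_exist[of g 0] mero[of "{0}"] eventually_frequently[OF _ g_nz[of 0]]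
    by (auto simp: c_def k_def meromorphic_at_iff)
  then obtain s where s: "s > 0" "zor_poly g 0 holomorphic_on cball 0 s"
    "\<And>w. w \<in> cball 0 s - {0} \<Longrightarrow> g w = zor_poly g 0 w * w powi k" by auto
  have "(zor_poly g 0) \<midarrow>0\<rightarrow> c"
    unfolding c_def using s(1,2) holomorphic_on_imp_continuous_on
    by (metis centre_in_ball continuous_on_interior interior_cball isCont_def)
  moreover have "P' analytic_on {0}"
    unfolding P'_def using 0 B_an B_0 by (intro analytic_intros) auto
  then have "P' \<midarrow>0\<rightarrow> P' 0" using analytic_at_imp_isCont isContD by blast
  ultimately have "(\<lambda>z. zor_poly g 0 z * of_real r powi k * P' z) \<midarrow>0\<rightarrow> c * of_real r powi k * P' 0"
    by (intro tendsto_intros)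
  moreover have "eventually (\<lambda>z. zor_poly g 0 z * of_real r powi k * P' z = H z) (at 0)"
  proof -
    have "eventually (\<lambda>z. z \<in> ball 0 s - {0}) (at (0::complex))"
      using s(1) by (intro eventually_at_in_open) auto
    then show ?thesis
    proof eventually_elim
      case (elim z)
      have "blaschke r 0 z powi (- k) * z powi k = of_real r powi k"
        using elim r by (simp add: blaschke_def power2_eq_square power_int_minus power_int_divide_distrib field_simps)
      moreover have "P z = blaschke r 0 z powi (- k) * P' z"
        unfolding P_def P'_def k_def using Z(1,3) by (rule prod.remove)
      moreover have "g z = zor_poly g 0 z * z powi k" using s(3) elim by auto
      ultimately show ?case by (simp add: H_def mult_ac)
    qed
  qed
  ultimately have "H \<midarrow>0\<rightarrow> c * of_real r powi k * P' 0"
    by (rule Lim_transform_eventually)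
  then have h0: "h 0 = c * of_real r powi k * P' 0" unfolding h_def by (rule remove_sings_eqI)
  have "ln (norm (blaschke r w 0 powi (- zorder g w))) = of_int (zorder g w) * disc_weight r w"
    if "w \<in> Z - {0}" for w
  proof -
    have "norm (blaschke r w 0) = norm w / r"
      using r by (simp add: blaschke_def norm_divide norm_mult power2_eq_square)
    then show ?thesis
      using that r by (simp add: norm_power_int ln_power_int disc_weight_def ln_div algebra_simps del: power_int_minus)
  qed
  moreover have "norm (blaschke r w 0 powi (- zorder g w)) \<noteq> 0" if "w \<in> Z - {0}" for w
    using that 0 B_0[of w 0] by auto
  ultimately have "ln (norm (P' 0)) = (\<Sum>w\<in>Z - {0}. of_int (zorder g w) * disc_weight r w)"
    unfolding P'_def prod_norm[symmetric] using Z(1) by (subst ln_prod) auto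
  moreover have "ln (norm (of_real r powi k :: complex)) = of_int (zorder g 0) * disc_weight r 0"
    using r by (simp add: norm_power_int ln_power_int disc_weight_def k_def)
  moreover have "P' 0 \<noteq> 0" "c \<noteq> 0" "(of_real r powi k :: complex) \<noteq> 0"
    using h_nz[OF 0] unfolding h0 by auto
  ultimately have "ln (norm (h 0)) = ln (norm c) + (of_int (zorder g 0) * disc_weight r 0 +
      (\<Sum>w\<in>Z - {0}. of_int (zorder g w) * disc_weight r w))"
    unfolding h0 norm_mult by (subst ln_mult | simp)+
  also have "\<dots> = ln (norm c) + (\<Sum>w\<in>Z. of_int (zorder g w) * disc_weight r w)"
    using sum.remove[OF Z(1,3), of "\<lambda>w. of_int (zorder g w) * disc_weight r w"] by simp
  finally show ?thesis
    using mean r by (simp add: c_def circle norm_mult)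
qed

section \<open>The counting function as a finite sum over poles\<close>

lemma poles_in_disc_finite:
  assumes "\<phi> meromorphic_on UNIV"
  shows "finite {z. is_pole \<phi> z \<and> norm z \<le> r}"
proof -
  have "{z. is_pole \<phi> z} sparse_in UNIV"
    using meromorphic_on_imp_not_pole_cosparse[OF assms] by (simp add: eventually_cosparse)
  then have "finite (cball 0 r \<inter> {z. is_pole \<phi> z})"
    by (intro sparse_in_compact_finite) (auto elim: sparse_in_subset)
  then show ?thesis by (rule rev_finite_subset) auto
qed

text \<open>The integral splits over the finitely many poles. A pole at z \<noteq> 0 is counted from
  t = \<open>norm z\<close> on and contributes its multiplicity times the integral of 1/t up to
  \<open>r\<close>; a pole at the origin contributes through the term with
  \<open>ln r\<close>.\<close>

lemma nevanlinna_N_eq_sum: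
  assumes \<phi>: "\<phi> meromorphic_on UNIV" and r: "r > 0"
  shows "nevanlinna_N \<phi> r = (\<Sum>z | is_pole \<phi> z \<and> norm z \<le> r. of_int (- zorder \<phi> z) * disc_weight r z)"
proof -
  define P where "P = {z. is_pole \<phi> z \<and> norm z \<le> r}"
  define m where "m = (\<lambda>z. of_int (- zorder \<phi> z) :: real)"
  have fin: "finite P" unfolding P_def by (rule poles_in_disc_finite[OF \<phi>])
  have count: "pole_count \<phi> t = (\<Sum>z\<in>P. if norm z \<le> t then m z else 0)" if "t \<le> r" for t
  proof -
    have "{z. is_pole \<phi> z \<and> norm z \<le> t} = P \<inter> {z. norm z \<le> t}" using that by (auto simp: P_def)
    then show ?thesis using fin by (simp add: pole_count_def m_def sum.inter_restrict cong: if_cong)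
  qed
  have count0: "pole_count \<phi> 0 = (\<Sum>z\<in>P. if z = 0 then m z else 0)"
    using count[of 0] r by simp
  have "((\<lambda>t. \<Sum>z\<in>P - {0}. m z * (if t \<in> {norm z..r} then 1 / t else 0)) has_integral
      (\<Sum>z\<in>P - {0}. m z * disc_weight r z)) {0..r}"
  proof (intro has_integral_sum has_integral_mult_right)
    fix z assume z: "z \<in> P - {0}"
    have "((\<lambda>t. 1 / t) has_integral (ln r - ln (norm z))) {norm z..r}"
    proof (rule fundamental_theorem_of_calculus)
      fix t assume "t \<in> {norm z..r}"
      then have "t > 0" using z by (metis DiffE atLeastAtMost_iff insertI1 less_le_trans zero_less_norm_iff)
      then show "(ln has_vector_derivative 1 / t) (at t within {norm z..r})"
        by (auto simp: has_real_derivative_iff_has_vector_derivative[symmetric] divide_inverse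
            intro!: derivative_eq_intros)
    qed (use z in \<open>auto simp: P_def\<close>)
    then show "((\<lambda>t. if t \<in> {norm z..r} then 1 / t else 0) has_integral disc_weight r z) {0..r}"
      using z r by (subst has_integral_restrict) (auto simp: disc_weight_def ln_div)
  qed (use fin in auto)
  then have "((\<lambda>t. (pole_count \<phi> t - pole_count \<phi> 0) / t) has_integral
      (\<Sum>z\<in>P - {0}. m z * disc_weight r z)) {0..r}"
  proof (rule has_integral_eq[rotated])
    fix t assume t: "t \<in> {0..r}"
    have "pole_count \<phi> t - pole_count \<phi> 0 = (\<Sum>z\<in>P. if z \<noteq> 0 \<and> norm z \<le> t then m z else 0)"
      using t by (simp add: count count0 flip: sum_subtractf) (intro sum.cong, auto)
    also have "\<dots> = (\<Sum>z\<in>P - {0}. if norm z \<le> t then m z else 0)"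
      using fin by (intro sum.mono_neutral_cong_right) auto
    finally show "(\<Sum>z\<in>P - {0}. m z * (if t \<in> {norm z..r} then 1 / t else 0)) =
        (pole_count \<phi> t - pole_count \<phi> 0) / t"
      using t by (simp add: sum_divide_distrib) (intro sum.cong, auto)
  qed
  then have "nevanlinna_N \<phi> r = (\<Sum>z\<in>P - {0}. m z * disc_weight r z) + pole_count \<phi> 0 * ln r"
    by (simp add: nevanlinna_N_def integral_unique)
  also have "\<dots> = (\<Sum>z\<in>P. m z * disc_weight r z)"
    using fin by (cases "0 \<in> P") (auto simp: count0 sum.remove[of P 0] disc_weight_def)
  finally show ?thesis by (simp add: P_def m_def)
qed

section \<open>Linear growth of the characteristic\<close>

definition circle_point :: "real \<Rightarrow> real \<Rightarrow> complex" where
  "circle_point r \<theta> = of_real r * exp (\<i> * of_real \<theta>)"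

lemma tendsto_diff_power_int:
  fixes w :: complex
  assumes "k \<ge> 0"
  shows "((\<lambda>z. (z - w) powi k) \<longlongrightarrow> (w - w) powi k) (at w)"
  unfolding power_int_def using assms by (simp only: if_True) (intro tendsto_intros)

text \<open>Let \<open>M\<close> be the total multiplicity of the poles of the
  \<open>\<phi> \<alpha>\<close> at \<open>w\<close>. Multiplied by \<open>(z - w) powi M\<close>,
  every summand has a finite limit, hence so has \<open>g\<close>, which rules out an order below
  \<open>- M\<close>. The sum of the multiplicities, instead of their maximum, is what matches a sum
  of counting functions.\<close>

lemma zorder_sum_ge:
  fixes \<phi> :: "'a \<Rightarrow> complex \<Rightarrow> complex" and A :: "'a set" and b :: "'a \<Rightarrow> complex" and w :: complex
  defines "g \<equiv> \<lambda>z. \<Sum>\<alpha>\<in>A. b \<alpha> * \<phi> \<alpha> z"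
    and "m \<equiv> \<lambda>\<alpha>. if is_pole (\<phi> \<alpha>) w then - zorder (\<phi> \<alpha>) w else 0"
  assumes "finite A" and \<phi>: "\<And>\<alpha>. \<alpha> \<in> A \<Longrightarrow> \<phi> \<alpha> meromorphic_on {w}"
    and nz: "eventually (\<lambda>z. g z \<noteq> 0) (at w)"
  shows "zorder g w \<ge> - (\<Sum>\<alpha>\<in>A. m \<alpha>)"
proof (rule ccontr)
  define M where "M = (\<Sum>\<alpha>\<in>A. m \<alpha>)"
  have m_nonneg: "m \<alpha> \<ge> 0" if "\<alpha> \<in> A" for \<alpha>
    using isolated_pole_imp_neg_zorder[of "\<phi> \<alpha>" w] \<phi>[OF that] by (auto simp: m_def meromorphic_at_iff)
  assume "\<not> ?thesis"
  then have less: "zorder g w < - M" by (simp add: M_def)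
  have M: "m \<alpha> \<le> M" if "\<alpha> \<in> A" for \<alpha>
    unfolding M_def using that m_nonneg \<open>finite A\<close> by (intro member_le_sum) auto
  have lim: "\<exists>l. ((\<lambda>z. \<phi> \<alpha> z * (z - w) powi M) \<longlongrightarrow> l) (at w)" if \<alpha>: "\<alpha> \<in> A" for \<alpha>
  proof (cases "is_pole (\<phi> \<alpha>) w")
    case False
    then obtain l where "(\<phi> \<alpha> \<longlongrightarrow> l) (at w)"
      using \<phi>[OF \<alpha>] by (auto simp: meromorphic_at_iff not_essential_def)
    moreover have "M \<ge> 0" unfolding M_def using m_nonneg by (rule sum_nonneg)
    then have "((\<lambda>z. (z - w) powi M) \<longlongrightarrow> (w - w) powi M) (at w)"
      by (rule tendsto_diff_power_int)
    ultimately show ?thesis by (intro exI) (rule tendsto_mult)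
  next
    case True
    let ?P = "zor_poly (\<phi> \<alpha>) w"
    have "eventually (\<lambda>z. \<phi> \<alpha> z \<noteq> 0) (at w)"
      using True non_zero_neighbour_pole by blast
    then obtain s where s: "s > 0" "?P holomorphic_on cball w s"
      "\<And>z. z \<in> cball w s - {w} \<Longrightarrow> \<phi> \<alpha> z = ?P z * (z - w) powi (zorder (\<phi> \<alpha>) w)"
      using zorder_exist[of "\<phi> \<alpha>" w] \<phi>[OF \<alpha>] by (auto simp: meromorphic_at_iff eventually_frequently)
    have "(?P \<longlongrightarrow> ?P w) (at w)"
      using s(1,2) holomorphic_on_imp_continuous_on
      by (metis centre_in_ball continuous_on_interior interior_cball isCont_def)
    moreover have "M - m \<alpha> \<ge> 0" using M[OF \<alpha>] by simp
    then have "((\<lambda>z. (z - w) powi (M - m \<alpha>)) \<longlongrightarrow> (w - w) powi (M - m \<alpha>)) (at w)"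
      by (rule tendsto_diff_power_int)
    ultimately have "((\<lambda>z. ?P z * (z - w) powi (M - m \<alpha>)) \<longlongrightarrow> ?P w * (w - w) powi (M - m \<alpha>)) (at w)"
      by (rule tendsto_mult)
    moreover have "eventually (\<lambda>z. ?P z * (z - w) powi (M - m \<alpha>) = \<phi> \<alpha> z * (z - w) powi M) (at w)"
    proof -
      have "eventually (\<lambda>z. z \<in> ball w s - {w}) (at w)"
        using s(1) by (intro eventually_at_in_open) auto
      then show ?thesis
      proof eventually_elim
        case (elim z)
        have "(z - w) powi (M - m \<alpha>) = (z - w) powi (zorder (\<phi> \<alpha>) w) * (z - w) powi M"
          using elim True by (subst power_int_add[symmetric]) (auto simp: m_def add.commute)
        then show ?case using s(3)[of z] elim by simp
      qed
    qed
    ultimately show ?thesis by (intro exI) (rule Lim_transform_eventually)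
  qed
  then have "\<forall>\<alpha>\<in>A. \<exists>l. ((\<lambda>z. \<phi> \<alpha> z * (z - w) powi M) \<longlongrightarrow> l) (at w)" by blast
  from bchoice[OF this] obtain l
    where "\<forall>\<alpha>\<in>A. ((\<lambda>z. \<phi> \<alpha> z * (z - w) powi M) \<longlongrightarrow> l \<alpha>) (at w)" ..
  then have "((\<lambda>z. \<Sum>\<alpha>\<in>A. b \<alpha> * (\<phi> \<alpha> z * (z - w) powi M)) \<longlongrightarrow> (\<Sum>\<alpha>\<in>A. b \<alpha> * l \<alpha>)) (at w)"
    by (intro tendsto_intros) auto
  then have glim: "((\<lambda>z. g z * (z - w) powi M) \<longlongrightarrow> (\<Sum>\<alpha>\<in>A. b \<alpha> * l \<alpha>)) (at w)"
    by (simp add: g_def sum_distrib_right mult.assoc)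
  \<comment> \<open>\<open>?k\<close> is the positive excess of the supposed pole order over
    \<open>M\<close>. Multiplying the finite limit by the power \<open>?k\<close> of
    \<open>z - w\<close> gives 0, but the product is \<open>zor_poly g w\<close>, which does not
    vanish at \<open>w\<close>.\<close>
  let ?P = "zor_poly g w" and ?k = "nat (- zorder g w - M)"
  have "g meromorphic_on {w}" unfolding g_def using \<phi> by (intro meromorphic_intros)
  then have P: "?P w \<noteq> 0" "\<exists>s>0. ?P holomorphic_on cball w s \<and>
      (\<forall>z\<in>cball w s - {w}. g z = ?P z * (z - w) powi (zorder g w) \<and> ?P z \<noteq> 0)"
    using zorder_exist[of g w] nz by (auto simp: meromorphic_at_iff eventually_frequently)
  from P(2) obtain s where s: "s > 0" "?P holomorphic_on cball w s"
      "\<forall>z\<in>cball w s - {w}. g z = ?P z * (z - w) powi (zorder g w) \<and> ?P z \<noteq> 0" by (elim exE conjE)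
  have "(?P \<longlongrightarrow> ?P w) (at w)"
    using s(1,2) holomorphic_on_imp_continuous_on
    by (metis centre_in_ball continuous_on_interior interior_cball isCont_def)
  moreover have "((\<lambda>z. (g z * (z - w) powi M) * (z - w) ^ ?k) \<longlongrightarrow>
      (\<Sum>\<alpha>\<in>A. b \<alpha> * l \<alpha>) * (w - w) ^ ?k) (at w)"
    by (intro tendsto_intros glim)
  then have "((\<lambda>z. (g z * (z - w) powi M) * (z - w) ^ ?k) \<longlongrightarrow> 0) (at w)"
    using less by (simp add: power_0_left)
  moreover have "eventually (\<lambda>z. (g z * (z - w) powi M) * (z - w) ^ ?k = ?P z) (at w)"
  proof -
    have "eventually (\<lambda>z. z \<in> ball w s - {w}) (at w)"
      using s(1) by (intro eventually_at_in_open) auto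
    then show ?thesis
    proof eventually_elim
      case (elim z)
      have "(z - w) ^ ?k = (z - w) powi (- zorder g w - M)"
        using less by (simp add: power_int_def)
      then have "(z - w) powi (zorder g w) * (z - w) powi M * (z - w) ^ ?k = 1"
        using elim by (simp add: power_int_add[symmetric])
      moreover have "g z = ?P z * (z - w) powi (zorder g w)"
        using bspec[OF s(3), of z] elim by auto
      ultimately show ?case by (simp add: mult.assoc)
    qed
  qed
  then have "(?P \<longlongrightarrow> 0) (at w)" if "((\<lambda>z. (g z * (z - w) powi M) * (z - w) ^ ?k) \<longlongrightarrow> 0) (at w)"
    by (rule Lim_transform_eventually[OF that])
  ultimately have "?P w = 0" by (intro tendsto_unique[of "at w" ?P]) auto
  then show False using P(1) by simp
qed

text \<open>
  The weight \<open>(cos \<theta> + (cos \<theta>)\<^sup>2) / 2\<close> is a minorant of \<open>max 0 (cos \<theta>)\<close> whose integral is elementary.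
\<close>

lemma has_integral_cos_weight: "((\<lambda>\<theta>. (cos \<theta> + (cos \<theta>)\<^sup>2) / 2) has_integral pi / 2) {0..2 * pi}"
proof -
  define F :: "real \<Rightarrow> real" where "F = (\<lambda>x. (sin x + (x + sin x * cos x) / 2) / 2)"
  have "((\<lambda>\<theta>. (cos \<theta> + (cos \<theta>)\<^sup>2) / 2) has_integral F (2 * pi) - F 0) {0..2 * pi}"
  proof (rule fundamental_theorem_of_calculus)
    fix x
    have "(F has_real_derivative (cos x + (1 + (cos x * cos x - sin x * sin x)) / 2) / 2) (at x within {0..2 * pi})"
      unfolding F_def by (auto intro!: derivative_eq_intros)
    moreover have "(cos x + (1 + (cos x * cos x - sin x * sin x)) / 2) / 2 = (cos x + (cos x)\<^sup>2) / 2"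
    proof -
      have "sin x * sin x = 1 - cos x * cos x"
        using sin_cos_squared_add[of x] by (simp add: power2_eq_square)
      then show ?thesis by (simp only: power2_eq_square) (simp add: field_simps)
    qed
    ultimately show "(F has_vector_derivative (cos x + (cos x)\<^sup>2) / 2) (at x within {0..2 * pi})"
      by (simp add: has_real_derivative_iff_has_vector_derivative)
  qed simp
  then show ?thesis by (simp add: F_def)
qed

lemma cos_weight_le:
  fixes \<theta> :: real
  shows "(cos \<theta> + (cos \<theta>)\<^sup>2) / 2 \<le> max 0 (cos \<theta>)"
proof (cases "cos \<theta> \<ge> 0")
  case True
  then have "cos \<theta> * cos \<theta> \<le> cos \<theta> * 1" by (intro mult_left_mono) auto
  then show ?thesis using True by (simp add: power2_eq_square)
next
  case False
  have "cos \<theta> * (1 + cos \<theta>) \<le> 0"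
    using False cos_ge_minus_one[of \<theta>] by (intro mult_nonpos_nonneg) linarith+
  then show ?thesis using False by (simp add: power2_eq_square algebra_simps)
qed

text \<open>Each \<open>x \<alpha>\<close> is at most \<open>exp (log_plus (x \<alpha>))\<close>,
  and the nonnegative values of \<open>log_plus\<close> may be summed in the exponent. After taking
  logarithms this bounds \<open>ln (norm g)\<close> by integrands of proximity functions.\<close>

lemma sum_le_exp_sum_log_plus:
  fixes x :: "'a \<Rightarrow> real"
  assumes "finite A" "\<And>\<alpha>. \<alpha> \<in> A \<Longrightarrow> x \<alpha> \<ge> 0"
  shows "(\<Sum>\<alpha>\<in>A. x \<alpha>) \<le> real (card A) * exp (\<Sum>\<alpha>\<in>A. log_plus (x \<alpha>))"
proof (rule sum_bounded_above)
  fix \<alpha> assume \<alpha>: "\<alpha> \<in> A"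
  have "x \<alpha> \<le> exp (log_plus (x \<alpha>))"
  proof (cases "x \<alpha> = 0")
    case False
    then have "x \<alpha> = exp (ln (x \<alpha>))" using assms(2)[OF \<alpha>] by simp
    also have "\<dots> \<le> exp (log_plus (x \<alpha>))" by (simp add: log_plus_def)
    finally show ?thesis .
  qed simp
  also have "log_plus (x \<alpha>) \<le> (\<Sum>\<alpha>\<in>A. log_plus (x \<alpha>))"
    using \<alpha> assms(1) by (intro member_le_sum) (auto simp: log_plus_def)
  finally show "x \<alpha> \<le> exp (\<Sum>\<alpha>\<in>A. log_plus (x \<alpha>))" by simp
qed

lemma continuous_on_circle_point: "continuous_on A (circle_point r)"
  unfolding circle_point_def by (intro continuous_intros)

lemma norm_circle_point: "r \<ge> 0 \<Longrightarrow> norm (circle_point r \<theta>) = r"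
  by (simp add: circle_point_def norm_mult)

lemma Re_circle_point: "Re (circle_point r \<theta>) = r * cos \<theta>"
  by (simp add: circle_point_def exp_Euler cos_of_real sin_of_real)

lemma integrable_log_plus_circle:
  assumes "\<And>z. norm z = r \<Longrightarrow> \<phi> analytic_on {z}" "r \<ge> 0"
  shows "(\<lambda>\<theta>. log_plus (norm (\<phi> (circle_point r \<theta>)))) integrable_on {0..2 * pi}"
proof (rule integrable_continuous_real)
  \<comment> \<open>In this form continuity is visible also where the function vanishes and
    \<open>ln\<close> itself is not continuous.\<close>
  have "log_plus y = ln (max 1 y)" if "y \<ge> 0" for y
    using that by (cases "y \<ge> 1"; cases "y = 0") (auto simp: log_plus_def)
  then have eq: "(\<lambda>\<theta>. log_plus (norm (\<phi> (circle_point r \<theta>)))) = (\<lambda>\<theta>. ln (max 1 (norm (\<phi> (circle_point r \<theta>)))))"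
    by auto
  have "continuous_on (sphere 0 r) \<phi>"
    using assms by (intro holomorphic_on_imp_continuous_on analytic_imp_holomorphic
        analytic_on_analytic_at[THEN iffD2]) auto
  then have "continuous_on {0..2 * pi} (\<lambda>\<theta>. \<phi> (circle_point r \<theta>))"
    by (rule continuous_on_compose2[OF _ continuous_on_circle_point]) (auto simp: norm_circle_point assms)
  then show "continuous_on {0..2 * pi} (\<lambda>\<theta>. log_plus (norm (\<phi> (circle_point r \<theta>))))"
    unfolding eq by (intro continuous_intros) auto
qed

text \<open>
  Jensen's formula bounds the mean of \<open>ln \<bar>g\<bar>\<close> on a circle from below by the counting functions of
  the \<open>\<phi> \<alpha>\<close>; the decay of \<open>g\<close> in the right half-plane bounds it from above by their proximity
  functions minus a positive multiple of \<open>r\<close>.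
\<close>

lemma characteristic_lower_bound:
  fixes \<phi> :: "'a \<Rightarrow> complex \<Rightarrow> complex" and A :: "'a set" and b :: "'a \<Rightarrow> complex"
  defines "g \<equiv> \<lambda>z. \<Sum>\<alpha>\<in>A. b \<alpha> * \<phi> \<alpha> z"
  assumes A: "finite A" and \<phi>: "\<And>\<alpha>. \<alpha> \<in> A \<Longrightarrow> \<phi> \<alpha> meromorphic_on UNIV"
    and nz: "\<forall>\<^sub>\<approx>z\<in>UNIV. g z \<noteq> 0"
    and decay: "\<forall>\<^sub>\<approx>z\<in>UNIV. norm (g z) \<le> K * (\<Sum>\<alpha>\<in>A. norm (\<phi> \<alpha> z)) * exp (- c * max 0 (Re z))"
    and c: "c > 0"
  shows "\<exists>D E. countable E \<and> (\<forall>r\<ge>1. r \<notin> E \<longrightarrow> c * r / 4 \<le> D + (\<Sum>\<alpha>\<in>A. nevanlinna_T (\<phi> \<alpha>) r))"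
proof -
  \<comment> \<open>The points where a coefficient is not analytic, \<open>g\<close> vanishes or the
    decay estimate fails. They form a sparse, hence countable set, and their moduli are the
    exceptional radii \<open>E\<close>.\<close>
  define X where "X = {z. \<not> ((\<forall>\<alpha>\<in>A. \<phi> \<alpha> analytic_on {z}) \<and> g z \<noteq> 0 \<and>
      norm (g z) \<le> K * (\<Sum>\<alpha>\<in>A. norm (\<phi> \<alpha> z)) * exp (- c * max 0 (Re z)))}"
  have "\<forall>\<^sub>\<approx>z\<in>UNIV. (\<forall>\<alpha>\<in>A. \<phi> \<alpha> analytic_on {z}) \<and> g z \<noteq> 0 \<and>
      norm (g z) \<le> K * (\<Sum>\<alpha>\<in>A. norm (\<phi> \<alpha> z)) * exp (- c * max 0 (Re z))"
    using A \<phi> by (intro eventually_conj nz decay eventually_ball_finite ballI meromorphic_on_imp_analytic_cosparse)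
  then have X: "X sparse_in UNIV" by (simp add: X_def eventually_cosparse)
  have g_mero: "g meromorphic_on UNIV" unfolding g_def using \<phi> by (intro meromorphic_intros)
  define k where "k = ln (norm (zor_poly g 0 0))"
  have "c * r / 4 \<le> (ln (K * real (card A)) - k) + (\<Sum>\<alpha>\<in>A. nevanlinna_T (\<phi> \<alpha>) r)"
    if r: "r \<ge> 1" "r \<notin> norm ` X" for r
  proof -
    have good: "(\<forall>\<alpha>\<in>A. \<phi> \<alpha> analytic_on {z})" "g z \<noteq> 0"
      "norm (g z) \<le> K * (\<Sum>\<alpha>\<in>A. norm (\<phi> \<alpha> z)) * exp (- c * max 0 (Re z))" if "z \<notin> X" for z
      using that by (auto simp: X_def)
    \<comment> \<open>\<open>jensen_formula\<close> asks for 0 in \<open>Z\<close>. As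
      \<open>r\<close> is the modulus of no point of \<open>X\<close>, all of \<open>Z\<close> lies
      in the open disc.\<close>
    define Z where "Z = insert 0 (cball 0 r \<inter> X)"
    have Z: "finite Z" "Z \<subseteq> ball 0 r" "0 \<in> Z"
      using sparse_in_compact_finite[of X "cball 0 r"] X r
      by (auto simp: Z_def intro: sparse_in_subset)
    have an: "g analytic_on {z}" if "z \<notin> X" for z
      unfolding g_def using good(1)[OF that] by (intro analytic_intros) auto
    have jensen: "((\<lambda>\<theta>. ln (norm (g (circle_point r \<theta>)))) has_integral
        2 * pi * (k + (\<Sum>w\<in>Z. of_int (zorder g w) * disc_weight r w))) {0..2 * pi}"
      unfolding circle_point_def k_def
      using r by (intro jensen_formula[OF g_mero _ Z]) (auto simp: Z_def an good)
    define S where "S = (\<lambda>\<theta>. \<Sum>\<alpha>\<in>A. log_plus (norm (\<phi> \<alpha> (circle_point r \<theta>))))"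
    have notX: "circle_point r \<theta> \<notin> X" for \<theta>
      using r norm_circle_point[of r \<theta>] by (auto simp: image_iff)
    have S: "(S has_integral (\<Sum>\<alpha>\<in>A. 2 * pi * nevanlinna_m (\<phi> \<alpha>) r)) {0..2 * pi}"
      unfolding S_def
    proof (intro has_integral_sum A)
      fix \<alpha> assume "\<alpha> \<in> A"
      then have "(\<lambda>\<theta>. log_plus (norm (\<phi> \<alpha> (circle_point r \<theta>)))) integrable_on {0..2 * pi}"
        using r good(1) by (intro integrable_log_plus_circle) auto
      then show "((\<lambda>\<theta>. log_plus (norm (\<phi> \<alpha> (circle_point r \<theta>)))) has_integral
          2 * pi * nevanlinna_m (\<phi> \<alpha>) r) {0..2 * pi}"
        by (simp add: nevanlinna_m_def circle_point_def has_integral_integral)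
    qed
    \<comment> \<open>Dividing by \<open>2 * pi\<close> turns the last term into the
      \<open>c * r / 4\<close> of the conclusion.\<close>
    have "((\<lambda>\<theta>. ln (K * real (card A)) + S \<theta> - c * r * ((cos \<theta> + (cos \<theta>)\<^sup>2) / 2)) has_integral
        (2 * pi * ln (K * real (card A)) + (\<Sum>\<alpha>\<in>A. 2 * pi * nevanlinna_m (\<phi> \<alpha>) r) - c * r * (pi / 2))) {0..2 * pi}"
      using has_integral_const_real[of "ln (K * real (card A))" 0 "2 * pi"]
      by (intro has_integral_diff has_integral_add has_integral_mult_right S has_integral_cos_weight) simp
    with jensen have "2 * pi * (k + (\<Sum>w\<in>Z. of_int (zorder g w) * disc_weight r w)) \<le>
        2 * pi * ln (K * real (card A)) + (\<Sum>\<alpha>\<in>A. 2 * pi * nevanlinna_m (\<phi> \<alpha>) r) - c * r * (pi / 2)"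
    proof (rule has_integral_le)
      fix \<theta>
      define z where "z = circle_point r \<theta>"
      have z: "z \<notin> X" using notX by (simp add: z_def)
      define q where "q = exp (- c * max 0 (Re z))"
      have "q > 0" by (simp add: q_def)
      \<comment> \<open>The logarithms below require \<open>K\<close> and \<open>card A\<close> to
        be positive; both follow from the decay estimate at a point where \<open>g\<close> does not
        vanish.\<close>
      have pos: "0 < norm (g z)" using good(2)[OF z] by simp
      also have le: "norm (g z) \<le> K * (\<Sum>\<alpha>\<in>A. norm (\<phi> \<alpha> z)) * q"
        using good(3)[OF z] by (simp add: q_def)
      finally have "K * (\<Sum>\<alpha>\<in>A. norm (\<phi> \<alpha> z)) * q > 0" .
      then have "K * (\<Sum>\<alpha>\<in>A. norm (\<phi> \<alpha> z)) > 0" using \<open>q > 0\<close> by (simp add: zero_less_mult_iff)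
      moreover have "(\<Sum>\<alpha>\<in>A. norm (\<phi> \<alpha> z)) \<ge> 0" by (intro sum_nonneg) auto
      ultimately have K: "K > 0" "card A > 0" using A by (auto simp: zero_less_mult_iff card_gt_0_iff)
      have "(\<Sum>\<alpha>\<in>A. norm (\<phi> \<alpha> z)) \<le> real (card A) * exp (S \<theta>)"
        unfolding S_def z_def[symmetric] using A by (intro sum_le_exp_sum_log_plus) auto
      then have "K * (\<Sum>\<alpha>\<in>A. norm (\<phi> \<alpha> z)) * q \<le> K * (real (card A) * exp (S \<theta>)) * q"
        using K \<open>q > 0\<close> by (intro mult_right_mono mult_left_mono) auto
      with le have "norm (g z) \<le> (K * real (card A)) * (exp (S \<theta>) * q)" by (simp add: mult_ac)
      then have "ln (norm (g z)) \<le> ln ((K * real (card A)) * (exp (S \<theta>) * q))"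
        using pos by (meson ln_le_cancel_iff less_le_trans)
      also have "\<dots> = ln (K * real (card A)) + (S \<theta> - c * max 0 (Re z))"
        using K by (subst ln_mult) (auto simp: q_def exp_add[symmetric])
      finally have "ln (norm (g z)) \<le> ln (K * real (card A)) + (S \<theta> - c * max 0 (Re z))" .
      moreover have "c * max 0 (Re z) \<ge> c * (r * ((cos \<theta> + (cos \<theta>)\<^sup>2) / 2))"
      proof -
        have "r * ((cos \<theta> + (cos \<theta>)\<^sup>2) / 2) \<le> r * max 0 (cos \<theta>)"
          using r cos_weight_le by (intro mult_left_mono) auto
        also have "\<dots> = max 0 (Re z)" using r by (simp add: z_def Re_circle_point max_def zero_le_mult_iff mult_le_0_iff)
        finally show ?thesis using c by (intro mult_left_mono) auto
      qed
      ultimately show "ln (norm (g (circle_point r \<theta>))) \<le>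
          ln (K * real (card A)) + S \<theta> - c * r * ((cos \<theta> + (cos \<theta>)\<^sup>2) / 2)"
        by (simp add: z_def mult.assoc)
    qed
    also have "\<dots> = 2 * pi * (ln (K * real (card A)) + (\<Sum>\<alpha>\<in>A. nevanlinna_m (\<phi> \<alpha>) r) - c * r / 4)"
      by (simp add: sum_distrib_left[symmetric] algebra_simps)
    finally have upper: "k + (\<Sum>w\<in>Z. of_int (zorder g w) * disc_weight r w) \<le>
        ln (K * real (card A)) + (\<Sum>\<alpha>\<in>A. nevanlinna_m (\<phi> \<alpha>) r) - c * r / 4"
      by (simp only: mult_le_cancel_left_pos[OF pi_gt_zero[THEN mult_pos_pos[OF zero_less_numeral]]])
    \<comment> \<open>Multiplicities extended by 0 write all the counting functions as sums over the
      one set \<open>Z\<close>, as in Jensen's formula for \<open>g\<close>.\<close>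
    define mult where "mult = (\<lambda>\<alpha> w. if is_pole (\<phi> \<alpha>) w then - zorder (\<phi> \<alpha>) w else 0)"
    have "(\<Sum>\<alpha>\<in>A. nevanlinna_N (\<phi> \<alpha>) r) = (\<Sum>\<alpha>\<in>A. \<Sum>w\<in>Z. of_int (mult \<alpha> w) * disc_weight r w)"
    proof (rule sum.cong)
      fix \<alpha> assume \<alpha>: "\<alpha> \<in> A"
      have sub: "{z. is_pole (\<phi> \<alpha>) z \<and> norm z \<le> r} \<subseteq> Z"
        using \<alpha> good(1) analytic_at_imp_no_pole by (fastforce simp: Z_def)
      have "nevanlinna_N (\<phi> \<alpha>) r =
          (\<Sum>z | is_pole (\<phi> \<alpha>) z \<and> norm z \<le> r. of_int (- zorder (\<phi> \<alpha>) z) * disc_weight r z)"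
        using r by (intro nevanlinna_N_eq_sum \<phi> \<alpha>) auto
      also have "\<dots> = (\<Sum>w\<in>Z. of_int (mult \<alpha> w) * disc_weight r w)"
        using Z sub by (intro sum.mono_neutral_cong_left) (auto simp: mult_def)
      finally show "nevanlinna_N (\<phi> \<alpha>) r = (\<Sum>w\<in>Z. of_int (mult \<alpha> w) * disc_weight r w)" .
    qed simp
    also have "\<dots> = (\<Sum>w\<in>Z. of_int (\<Sum>\<alpha>\<in>A. mult \<alpha> w) * disc_weight r w)"
      by (subst sum.swap) (simp add: sum_distrib_right)
    \<comment> \<open>Pointwise comparison of the order of \<open>g\<close> with the total pole
      multiplicity; the weights are nonnegative because r \<ge> 1.\<close>
    also have "\<dots> \<ge> (\<Sum>w\<in>Z. - (of_int (zorder g w) * disc_weight r w))"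
    proof (rule sum_mono)
      fix w assume w: "w \<in> Z"
      have "- (\<Sum>\<alpha>\<in>A. mult \<alpha> w) \<le> zorder g w"
        unfolding g_def mult_def
      proof (rule zorder_sum_ge[OF A])
        show "\<phi> \<alpha> meromorphic_on {w}" if "\<alpha> \<in> A" for \<alpha> by (rule meromorphic_on_subset[OF \<phi>[OF that]]) auto
        show "eventually (\<lambda>z. (\<Sum>\<alpha>\<in>A. b \<alpha> * \<phi> \<alpha> z) \<noteq> 0) (at w)"
          using eventually_cosparse_imp_eventually_at[OF nz, of w] by (simp add: g_def)
      qed
      then have "- real_of_int (zorder g w) \<le> of_int (\<Sum>\<alpha>\<in>A. mult \<alpha> w)" by linarith
      moreover have "disc_weight r w \<ge> 0" using r w Z(2) by (intro disc_weight_nonneg) auto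
      ultimately have "- real_of_int (zorder g w) * disc_weight r w \<le> of_int (\<Sum>\<alpha>\<in>A. mult \<alpha> w) * disc_weight r w"
        by (rule mult_right_mono)
      then show "- (of_int (zorder g w) * disc_weight r w) \<le> of_int (\<Sum>\<alpha>\<in>A. mult \<alpha> w) * disc_weight r w"
        by simp
    qed
    finally have "- (\<Sum>\<alpha>\<in>A. nevanlinna_N (\<phi> \<alpha>) r) \<le> (\<Sum>w\<in>Z. of_int (zorder g w) * disc_weight r w)"
      by (simp add: sum_negf)
    with upper show ?thesis by (simp add: nevanlinna_T_def sum.distrib)
  qed
  moreover have "countable (norm ` X)"
    using sparse_imp_countable[OF open_UNIV X] by simp
  ultimately show ?thesis by blast
qed

section \<open>Independence of the zeta shifts\<close>

text \<open>For n > N and Re z \<ge> \<sigma>, passing from exponent \<sigma> to \<open>z\<close>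
  shrinks the modulus of each term by a factor of at most
  \<open>real (Suc N) powr (\<sigma> - Re z)\<close>. Absolute convergence at \<sigma> then gives a
  constant independent of \<open>z\<close>.\<close>

lemma dirichlet_tail_bound:
  fixes a :: "nat \<Rightarrow> complex"
  assumes "((\<lambda>n. a n * of_nat n powr (- of_real \<sigma>)) has_sum F) {0<..}"
  shows "\<exists>C\<ge>0. \<forall>z t. Re z \<ge> \<sigma> \<longrightarrow> ((\<lambda>n. a n * of_nat n powr (- z)) has_sum t) {N<..} \<longrightarrow>
    norm t \<le> C * real (Suc N) powr (- Re z)"
proof -
  define u where "u = (\<lambda>n. norm (a n) * real n powr (- \<sigma>))"
  have nrm: "norm (a n * of_nat n powr (- z)) = norm (a n) * real n powr (- Re z)" for n z
    using norm_powr_real_powr[of "of_nat n" "- z"] by (simp add: norm_mult)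
  have "(\<lambda>n. norm (a n * of_nat n powr (- of_real \<sigma>))) summable_on {0<..}"
    using summable_on_iff_abs_summable_on_complex[THEN iffD1, OF has_sum_imp_summable[OF assms]] .
  then have "u summable_on {0<..}" by (simp add: nrm u_def)
  then have u: "u summable_on {N<..}" by (rule summable_on_subset_banach) auto
  have u_nonneg: "u n \<ge> 0" for n by (simp add: u_def)
  have "norm t \<le> (infsum u {N<..} * real (Suc N) powr \<sigma>) * real (Suc N) powr (- Re z)"
    if z: "Re z \<ge> \<sigma>" and t: "((\<lambda>n. a n * of_nat n powr (- z)) has_sum t) {N<..}" for z t
  proof -
    define d where "d = real (Suc N) powr (\<sigma> - Re z)"
    have "norm (a n * of_nat n powr (- z)) \<le> u n * d" if "n \<in> {N<..}" for n
    proof -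
      have n: "real n \<ge> real (Suc N)" using that by simp
      then have "real n powr (- Re z) = real n powr (- \<sigma>) * real n powr (\<sigma> - Re z)"
        by (simp flip: powr_add)
      also have "\<dots> \<le> real n powr (- \<sigma>) * d"
        unfolding d_def using z n by (intro mult_left_mono powr_mono2') auto
      finally show ?thesis unfolding nrm u_def mult.assoc by (intro mult_left_mono) auto
    qed
    then have "norm t \<le> infsum u {N<..} * d"
      using norm_infsum_le[OF t has_sum_cmult_left[OF has_sum_infsum[OF u]], of d] by blast
    also have "d = real (Suc N) powr \<sigma> * real (Suc N) powr (- Re z)"
      by (simp add: d_def flip: powr_add)
    finally show ?thesis by (simp add: mult.assoc)
  qed
  moreover have "infsum u {N<..} * real (Suc N) powr \<sigma> \<ge> 0"
    using u_nonneg by (intro mult_nonneg_nonneg infsum_nonneg) auto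
  ultimately show ?thesis by blast
qed

text \<open>The equation is asked for off a sparse set, which is how an identity of meromorphic
  functions reads for representatives that take the value 0 at poles. For the same representatives a
  coefficient that vanishes as a meromorphic function is the function 0.\<close>

theorem theorem1:
  fixes m :: nat and s :: "nat \<Rightarrow> complex" and f :: fun_mpoly
  assumes "inj_on s {..m}"
    and "\<And>\<alpha>. \<alpha> \<in> Poly_Mapping.keys f \<Longrightarrow> Poly_Mapping.keys \<alpha> \<subseteq> {..m}"
    and "\<And>\<alpha>. Poly_Mapping.lookup f \<alpha> nicely_meromorphic_on UNIV"
    and "\<And>\<alpha>. nevanlinna_T (Poly_Mapping.lookup f \<alpha>) \<in> o[at_top](\<lambda>r. r)"
    and "\<forall>\<^sub>\<approx>w\<in>UNIV. eval_fun_mpoly f w (\<lambda>i. zeta (w + s i)) = 0"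
  shows "f = 0"
proof (rule ccontr)
  assume "f \<noteq> 0"
  define A where "A = Poly_Mapping.keys f"
  define \<phi> where "\<phi> = Poly_Mapping.lookup f"
  have finA: "finite A" by (simp add: A_def)
  have nice: "\<phi> \<alpha> nicely_meromorphic_on UNIV" for \<alpha>
    using assms(3) by (simp add: \<phi>_def)
  then have mero: "\<phi> \<alpha> meromorphic_on UNIV" for \<alpha>
    by (simp add: nicely_meromorphic_on_def)
  define F where "F = (\<lambda>\<alpha> w. \<Prod>i\<in>Poly_Mapping.keys \<alpha>. zeta (w + s i) ^ Poly_Mapping.lookup \<alpha> i)"
  have "\<exists>a \<sigma>. (\<forall>\<alpha>\<in>A. \<forall>w. Re w > \<sigma> \<longrightarrow>
      ((\<lambda>n. a \<alpha> n * of_nat n powr (- w)) has_sum F \<alpha> w) {0<..}) \<and>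
    (\<forall>c. (\<forall>n>0. (\<Sum>\<alpha>\<in>A. c \<alpha> * a \<alpha> n) = 0) \<longrightarrow> (\<forall>\<alpha>\<in>A. c \<alpha> = 0))"
    unfolding F_def A_def by (rule zeta_shift_monomials_independent[OF assms(1) finite_keys assms(2)])
  then obtain a \<sigma>0 where has_sum_all: "\<forall>\<alpha>\<in>A. \<forall>w. Re w > \<sigma>0 \<longrightarrow>
      ((\<lambda>n. a \<alpha> n * of_nat n powr (- w)) has_sum F \<alpha> w) {0<..}"
    and indep: "\<forall>c. (\<forall>n>0. (\<Sum>\<alpha>\<in>A. c \<alpha> * a \<alpha> n) = 0) \<longrightarrow> (\<forall>\<alpha>\<in>A. c \<alpha> = 0)"
    by (elim exE conjE)
  have has_sum_F: "((\<lambda>n. a \<alpha> n * of_nat n powr (- w)) has_sum F \<alpha> w) {0<..}"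
    if "\<alpha> \<in> A" "Re w > \<sigma>0" for \<alpha> w
    using has_sum_all that by simp
  have analytic: "\<forall>\<^sub>\<approx>w\<in>UNIV. \<forall>\<alpha>\<in>A. \<phi> \<alpha> analytic_on {w}"
    by (intro eventually_ball_finite finA ballI meromorphic_on_imp_analytic_cosparse mero)
  define g where "g = (\<lambda>n z. \<Sum>\<alpha>\<in>A. a \<alpha> n * \<phi> \<alpha> z)"
  have g_mero: "g n meromorphic_on UNIV" for n
    unfolding g_def by (intro meromorphic_intros mero)
  have g_dichotomy: "(\<forall>\<^sub>\<approx>z\<in>UNIV. g n z = 0) \<or> (\<forall>\<^sub>\<approx>z\<in>UNIV. g n z \<noteq> 0)" for n
    by (rule meromorphic_imp_constant_or_avoid[OF g_mero]) auto

  \<comment> \<open>At a point \<open>w\<close> where all coefficients are analytic and one is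
    nonzero, the values \<open>\<phi> \<beta> w\<close> are constants that are not all 0, so by
    independence some combination \<open>g n w\<close> is nonzero.\<close>
  have "\<exists>n>0. \<not> (\<forall>\<^sub>\<approx>z\<in>UNIV. g n z = 0)"
  proof -
    obtain \<alpha> where \<alpha>: "\<alpha> \<in> A" "\<phi> \<alpha> \<noteq> 0"
      using \<open>f \<noteq> 0\<close> by (metis A_def \<phi>_def in_keys_iff poly_mapping_eqI lookup_zero)
    then obtain x where "\<phi> \<alpha> x \<noteq> 0" by (auto simp: fun_eq_iff)
    then have "\<forall>\<^sub>\<approx>w\<in>UNIV. \<phi> \<alpha> w \<noteq> 0"
      using nicely_meromorphic_imp_constant_or_avoid[OF nice, of \<alpha> 0] by auto
    with analytic have "\<forall>\<^sub>\<approx>w\<in>UNIV. (\<forall>\<alpha>\<in>A. \<phi> \<alpha> analytic_on {w}) \<and> \<phi> \<alpha> w \<noteq> 0"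
      by (rule eventually_conj)
    then have "\<exists>w. (\<forall>\<alpha>\<in>A. \<phi> \<alpha> analytic_on {w}) \<and> \<phi> \<alpha> w \<noteq> 0"
      by (intro eventually_happens'[of "cosparse UNIV"]) simp_all
    then obtain w where w: "\<And>\<beta>. \<beta> \<in> A \<Longrightarrow> \<phi> \<beta> analytic_on {w}" "\<phi> \<alpha> w \<noteq> 0" by blast
    obtain n where n: "n > 0" "g n w \<noteq> 0"
      using indep[rule_format, of "\<lambda>\<beta>. \<phi> \<beta> w" \<alpha>] \<alpha>(1) w(2) by (auto simp: g_def mult.commute)
    have "g n analytic_on {w}" unfolding g_def by (intro analytic_intros w(1))
    then have "eventually (\<lambda>z. g n z \<noteq> 0) (at w)"
      using n(2) by (rule analytic_at_neq_imp_eventually_neq)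
    then have "frequently (\<lambda>z. \<not> g n z = 0) (at w)"
      by (intro eventually_frequently) auto
    then have "\<not> (\<forall>\<^sub>\<approx>z\<in>UNIV. g n z = 0)"
      using eventually_cosparse_imp_eventually_at[of "\<lambda>z. g n z = 0" UNIV w UNIV]
      by (auto simp: frequently_def)
    then show ?thesis using n(1) by auto
  qed
  then obtain N where N: "N > 0" "\<not> (\<forall>\<^sub>\<approx>z\<in>UNIV. g N z = 0)"
    and N_least: "\<And>n. n > 0 \<Longrightarrow> n < N \<Longrightarrow> \<forall>\<^sub>\<approx>z\<in>UNIV. g n z = 0"
    using exists_least_iff[of "\<lambda>n. n > 0 \<and> \<not> (\<forall>\<^sub>\<approx>z\<in>UNIV. g n z = 0)"] by blast
  have gN: "\<forall>\<^sub>\<approx>z\<in>UNIV. g N z \<noteq> 0" using g_dichotomy N(2) by blast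

  \<comment> \<open>To the right of \<sigma> all the series converge, and Re z is positive there, so
    \<open>max 0 (Re z)\<close> is Re z.\<close>
  define \<sigma> where "\<sigma> = max 0 \<sigma>0 + 1"
  have "\<exists>C\<ge>0. \<forall>z t. Re z \<ge> \<sigma> \<longrightarrow> ((\<lambda>n. a \<alpha> n * of_nat n powr (- z)) has_sum t) {N<..} \<longrightarrow>
      norm t \<le> C * real (Suc N) powr (- Re z)" if "\<alpha> \<in> A" for \<alpha>
    by (rule dirichlet_tail_bound[OF has_sum_F[OF that]]) (simp add: \<sigma>_def)
  then obtain C where C: "\<And>\<alpha>. \<alpha> \<in> A \<Longrightarrow> C \<alpha> \<ge> 0"
    "\<And>\<alpha> z t. \<alpha> \<in> A \<Longrightarrow> Re z \<ge> \<sigma> \<Longrightarrow> ((\<lambda>n. a \<alpha> n * of_nat n powr (- z)) has_sum t) {N<..} \<Longrightarrow>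
      norm t \<le> C \<alpha> * real (Suc N) powr (- Re z)"
    by metis
  \<comment> \<open>The first omitted term has size \<open>real (Suc N) powr (- Re z)\<close>;
    relative to \<open>real N powr (- Re z)\<close> this is \<open>exp (- c * Re z)\<close>.\<close>
  define c where "c = ln (real (Suc N)) - ln (real N)"
  have c: "c > 0" using N(1) by (simp add: c_def)
  \<comment> \<open>One constant for both sides of \<sigma>: \<open>C \<alpha>\<close> bounds the
    tails on the right, and \<open>exp (c * \<sigma>)\<close> makes up on the left for the decay
    factor, which is at least \<open>exp (- c * \<sigma>)\<close> there.\<close>
  define K where "K = (\<Sum>\<alpha>\<in>A. C \<alpha> + norm (a \<alpha> N) * exp (c * \<sigma>))"
  have K_nonneg: "K \<ge> 0"
    unfolding K_def using C(1) by (intro sum_nonneg add_nonneg_nonneg mult_nonneg_nonneg) auto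
  have K_ge: "C \<alpha> + norm (a \<alpha> N) * exp (c * \<sigma>) \<le> K" if "\<alpha> \<in> A" for \<alpha>
    unfolding K_def using that C(1) finA by (intro member_le_sum) auto
  have decay: "\<forall>\<^sub>\<approx>z\<in>UNIV. norm (g N z) \<le> K * (\<Sum>\<alpha>\<in>A. norm (\<phi> \<alpha> z)) * exp (- c * max 0 (Re z))"
  proof -
    have "\<forall>\<^sub>\<approx>z\<in>UNIV. \<forall>n\<in>{0<..<N}. g n z = 0"
      using N_least by (intro eventually_ball_finite) auto
    with assms(5) show ?thesis
    proof eventually_elim
      case (elim z)
      show ?case
      proof (cases "Re z \<ge> \<sigma>")
        case False
        have "norm (g N z) \<le> (\<Sum>\<alpha>\<in>A. norm (a \<alpha> N) * norm (\<phi> \<alpha> z))"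
          unfolding g_def by (rule order_trans[OF norm_sum]) (simp add: norm_mult)
        also have "\<dots> \<le> (\<Sum>\<alpha>\<in>A. K * norm (\<phi> \<alpha> z) * exp (- c * max 0 (Re z)))"
        proof (rule sum_mono)
          fix \<alpha> assume \<alpha>: "\<alpha> \<in> A"
          have "norm (a \<alpha> N) = norm (a \<alpha> N) * exp (c * \<sigma>) * exp (- c * \<sigma>)"
            by (simp add: mult.assoc flip: exp_add)
          also have "\<dots> \<le> K * exp (- c * max 0 (Re z))"
            using False c K_ge[OF \<alpha>] C(1)[OF \<alpha>] K_nonneg by (intro mult_mono) (auto simp: \<sigma>_def)
          finally have "norm (a \<alpha> N) * norm (\<phi> \<alpha> z) \<le> K * exp (- c * max 0 (Re z)) * norm (\<phi> \<alpha> z)"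
            by (rule mult_right_mono) simp
          then show "norm (a \<alpha> N) * norm (\<phi> \<alpha> z) \<le> K * norm (\<phi> \<alpha> z) * exp (- c * max 0 (Re z))"
            by (simp add: mult_ac)
        qed
        finally show ?thesis by (simp add: sum_distrib_left sum_distrib_right)
      next
        case True
        \<comment> \<open>The tail beyond \<open>N\<close> of the Dirichlet series of the
          monomial.\<close>
        define t where "t = (\<lambda>\<alpha>. F \<alpha> z - (\<Sum>n\<in>{0<..N}. a \<alpha> n * of_nat n powr (- z)))"
        have t: "norm (t \<alpha>) \<le> C \<alpha> * real (Suc N) powr (- Re z)" if \<alpha>: "\<alpha> \<in> A" for \<alpha>
        proof (rule C(2)[OF \<alpha> True])
          have "((\<lambda>n. a \<alpha> n * of_nat n powr (- z)) has_sum F \<alpha> z) {0<..}"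
            by (rule has_sum_F[OF \<alpha>]) (use True in \<open>simp add: \<sigma>_def\<close>)
          moreover have "((\<lambda>n. a \<alpha> n * of_nat n powr (- z)) has_sum
              (\<Sum>n\<in>{0<..N}. a \<alpha> n * of_nat n powr (- z))) {0<..N}"
            by (rule has_sum_finite) simp
          ultimately have "((\<lambda>n. a \<alpha> n * of_nat n powr (- z)) has_sum t \<alpha>) ({0<..} - {0<..N})"
            unfolding t_def by (rule has_sum_Diff) auto
          moreover have "{0<..} - {0<..N} = {N<..}" by auto
          ultimately show "((\<lambda>n. a \<alpha> n * of_nat n powr (- z)) has_sum t \<alpha>) {N<..}" by simp
        qed
        have "0 = (\<Sum>\<alpha>\<in>A. \<phi> \<alpha> z * F \<alpha> z)"
          using elim by (simp add: eval_fun_mpoly_def A_def \<phi>_def F_def)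
        also have "\<dots> = (\<Sum>\<alpha>\<in>A. \<phi> \<alpha> z * t \<alpha>) + (\<Sum>\<alpha>\<in>A. \<Sum>n\<in>{0<..N}. \<phi> \<alpha> z * (a \<alpha> n * of_nat n powr (- z)))"
          by (simp add: t_def sum_distrib_left right_diff_distrib sum_subtractf)
        also have "(\<Sum>\<alpha>\<in>A. \<Sum>n\<in>{0<..N}. \<phi> \<alpha> z * (a \<alpha> n * of_nat n powr (- z))) =
            (\<Sum>n\<in>{0<..N}. g n z * of_nat n powr (- z))"
          by (subst sum.swap) (simp only: g_def sum_distrib_left sum_distrib_right mult_ac)
        \<comment> \<open>By minimality of \<open>N\<close> all terms with n < N vanish at
          \<open>z\<close>, so the equation expresses \<open>g N z\<close> through the tails
          alone.\<close>
        also have "\<dots> = g N z * of_nat N powr (- z)"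
          using elim N(1) by (subst sum.remove[of _ N]) (auto intro!: sum.neutral)
        finally have "g N z * of_nat N powr (- z) = - (\<Sum>\<alpha>\<in>A. \<phi> \<alpha> z * t \<alpha>)"
          by (simp add: add_eq_0_iff)
        then have "norm (g N z) * norm (of_nat N powr (- z) :: complex) = norm (\<Sum>\<alpha>\<in>A. \<phi> \<alpha> z * t \<alpha>)"
          by (metis norm_minus_cancel norm_mult)
        also have "\<dots> \<le> (\<Sum>\<alpha>\<in>A. norm (\<phi> \<alpha> z) * (K * real (Suc N) powr (- Re z)))"
        proof (rule order_trans[OF norm_sum], rule sum_mono)
          fix \<alpha> assume \<alpha>: "\<alpha> \<in> A"
          have "0 \<le> norm (a \<alpha> N) * exp (c * \<sigma>)" by simp
          then have "C \<alpha> \<le> K" using K_ge[OF \<alpha>] by linarith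
          then have "C \<alpha> * real (Suc N) powr (- Re z) \<le> K * real (Suc N) powr (- Re z)"
            by (rule mult_right_mono) simp
          with t[OF \<alpha>] have "norm (t \<alpha>) \<le> K * real (Suc N) powr (- Re z)" by (rule order_trans)
          then show "norm (\<phi> \<alpha> z * t \<alpha>) \<le> norm (\<phi> \<alpha> z) * (K * real (Suc N) powr (- Re z))"
            unfolding norm_mult by (intro mult_left_mono) auto
        qed
        also have "\<dots> = K * (\<Sum>\<alpha>\<in>A. norm (\<phi> \<alpha> z)) * real (Suc N) powr (- Re z)"
          by (simp only: sum_distrib_left sum_distrib_right mult_ac)
        finally have le: "norm (g N z) * real N powr (- Re z) \<le>
            K * (\<Sum>\<alpha>\<in>A. norm (\<phi> \<alpha> z)) * real (Suc N) powr (- Re z)"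
          using norm_powr_real_powr[of "of_nat N" "- z"] by simp
        have exp_eq: "real N powr Re z * real (Suc N) powr (- Re z) = exp (- c * max 0 (Re z))"
          using True N(1) by (simp add: powr_def c_def \<sigma>_def algebra_simps flip: exp_add)
        have "norm (g N z) = real N powr Re z * (norm (g N z) * real N powr (- Re z))"
          using N(1) by (simp add: powr_minus)
        also have "\<dots> \<le> real N powr Re z * (K * (\<Sum>\<alpha>\<in>A. norm (\<phi> \<alpha> z)) * real (Suc N) powr (- Re z))"
          using le by (rule mult_left_mono) simp
        also have "\<dots> = K * (\<Sum>\<alpha>\<in>A. norm (\<phi> \<alpha> z)) * (real N powr Re z * real (Suc N) powr (- Re z))"
          by (simp only: mult_ac)
        finally show ?thesis unfolding exp_eq .
      qed
    qed
  qed

  obtain D E where E: "countable E"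
    and bound: "\<And>r. r \<ge> 1 \<Longrightarrow> r \<notin> E \<Longrightarrow> c * r / 4 \<le> D + (\<Sum>\<alpha>\<in>A. nevanlinna_T (\<phi> \<alpha>) r)"
    using characteristic_lower_bound[of A \<phi> "\<lambda>\<alpha>. a \<alpha> N", OF finA mero _ _ c] gN decay
    unfolding g_def by blast
  have "(\<lambda>r. \<Sum>\<alpha>\<in>A. nevanlinna_T (\<phi> \<alpha>) r) \<in> o[at_top](\<lambda>r. r)"
    using assms(4) by (intro big_sum_in_smallo) (auto simp: \<phi>_def)
  \<comment> \<open>The bound \<open>c / 8\<close> is half of the growth rate \<open>c / 4\<close>
    forced from below; the other half must then be absorbed by the constant \<open>D\<close>, which
    fails once r > 8 D / c.\<close>
  then have "eventually (\<lambda>r. norm (\<Sum>\<alpha>\<in>A. nevanlinna_T (\<phi> \<alpha>) r) \<le> c / 8 * norm r) at_top"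
    using c by (intro landau_o.smallD) auto
  then obtain R where R: "\<And>r. r \<ge> R \<Longrightarrow> norm (\<Sum>\<alpha>\<in>A. nevanlinna_T (\<phi> \<alpha>) r) \<le> c / 8 * norm r"
    by (auto simp: eventually_at_top_linorder)
  define R' where "R' = max (max 1 R) (8 * D / c)"
  \<comment> \<open>The lower bound may fail on the countable set \<open>E\<close>, so a large
    radius outside \<open>E\<close> is taken from an interval.\<close>
  have "uncountable {R'<..<R' + 1}" by (rule uncountable_open_interval[THEN iffD2]) simp
  then have "\<not> {R'<..<R' + 1} \<subseteq> E" using E countable_subset by blast
  then obtain r where r: "r \<in> {R'<..<R' + 1}" "r \<notin> E" by blast
  then have "r \<ge> 1" "r \<ge> R" "c * r / 8 > D"
    using c by (auto simp: R'_def field_simps)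
  then show False using bound[of r] R[of r] r(2) by (auto simp: abs_le_iff)
qed

end
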